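(* Let $(\eta_0,u_0)\in \widetilde{C}^2_0\times C^3_0$, let $T>0$, and let $(\eta,u)\in H^1_T\times H^2_T$ be the solution on $[0,T]$ of the system of integral equations $$\eta(x,t)=\eta_0(x)+\int_0^t \left[ L_N\!\left(\tfrac{a+b}{b}u+\eta u\right)+\tfrac{a}{b}u_x \right] d\tau,\qquad u(x,t)=u_0(x)+\int_0^t L_D\!\left(\eta+\tfrac{1}{2}u^2\right)d\tau .$$ Then $(\eta,u)\in C(0,T;\widetilde{C}^2_0)\times C(0,T;C^3_0)$, the pair $(\eta,u)$ satisfies pointwise in $[0,T]$ the initial-boundary value problem $$\begin{aligned} &\eta_t+u_x+(\eta u)_x+a u_{xxx}-b \eta_{xxt} =0,\\ &u_t+\eta_x+uu_x -du_{xxt}=0,\\ &\eta(x,0)=\eta_0(x),\quad u(x,0)=u_0(x),\\ &u(-L,t)=u(L,t)=0,\quad u_{xx}(-L,t)=u_{xx}(L,t)=0, \end{aligned}$$ for $x\in(-L,L)$, and $(\eta_t,u_t)\in C(0,T;\widetilde{C}^2_0)\times C(0,T;C^3_0)$.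
   Context: Fix $L>0$ and real parameters $a<0$, $b>0$, $d>0$ with $a+b+d=\tfrac13$. $H^s=H^s(-L,L)$ are the real Sobolev spaces with norm $\|v\|_s=\left(\sum_{j=0}^s\|\partial_x^jv\|_{L^2}^2\right)^{1/2}$; $H^1_0=\{v\in H^1: v(L)=v(-L)=0\}$. $C(0,T;X)$ denotes continuous functions of $t\in[0,T]$ with values in $X$; $H^1_T:=C(0,T;H^1)$ and $H^2_T:=C(0,T;H^2\cap H^1_0)$. $C^s=C^s(-L,L)$ is the Banach space of real-valued $s$-times continuously differentiable functions on $[-L,L]$ with norm $\|v\|_{C^s}=\sup_{0\le j\le s}\sup_{x\in[-L,L]}|\partial_x^jv(x)|$, and $$C_0^{3}:=\{w\in C^{3}: w(\pm L)=0,\ w_{xx}(\pm L)=0\},\qquad \widetilde C_0^2:=\{v\in C^2: v_x(\pm L)=0\}.$$ The operator $L_N$ is defined by $(L_Nf)(x)=\int_{-L}^{L}F_\xi(x,\xi)f(\xi)\,d\xi$, where $F_\xi=\partial F/\partial\xi$, $$F(x,\xi)=-\frac{1}{bW}\begin{cases}\omega_1(\xi)\omega_2(x), & -L\le\xi\le x,\\ \omega_1(x)\omega_2(\xi), & x<\xi\le L,\end{cases}$$ $\omega_1(x)=\cosh\left(\frac{L+x}{\sqrt b}\right)$, $\omega_2(x)=\cosh\left(\frac{L-x}{\sqrt b}\right)$, $W=-\frac{1}{\sqrt b}\sinh\left(\frac{2L}{\sqrt b}\right)$ ($F$ is the Green's function of $w-bw_{xx}=-f_x$, $w_x(\pm L)=0$).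 The operator $L_D$ is defined by $(L_Df)(x)=\int_{-L}^{L}G_\xi(x,\xi)f(\xi)\,d\xi$, where $G$ is given by the same formula with $b$ replaced by $d$, $\omega_1(x)=\sinh\left(\frac{L+x}{\sqrt d}\right)$, $\omega_2(x)=\sinh\left(\frac{L-x}{\sqrt d}\right)$, $W=-\frac{1}{\sqrt d}\sinh\left(\frac{2L}{\sqrt d}\right)$ ($G$ is the Green's function of $w-dw_{xx}=-f_x$, $w(\pm L)=0$). Both operators act in the variable $x$ at each fixed time. *)

theory Defs
  imports "HOL-Analysis.Analysis"
begin

text \<open>A space-time function \<open>v(x,t)\<close> is written \<open>v t x\<close>, so that \<open>v t\<close> is a function of \<open>x\<close>.
  Functions on \<open>[-L,L]\<close> (resp. \<open>[0,T]\<close>) are represented by functions on \<open>real\<close> whose values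
  outside the interval are irrelevant; derivatives at the endpoints are one-sided.\<close>

definition Dx :: "real \<Rightarrow> (real \<Rightarrow> real) \<Rightarrow> real \<Rightarrow> real" where
  "Dx L f x = vector_derivative f (at x within {-L..L})"

definition Dt :: "real \<Rightarrow> (real \<Rightarrow> real \<Rightarrow> real) \<Rightarrow> real \<Rightarrow> real \<Rightarrow> real" where
  "Dt T v t x = vector_derivative (\<lambda>\<tau>. v \<tau> x) (at t within {0..T})"


definition C_space :: "real \<Rightarrow> nat \<Rightarrow> (real \<Rightarrow> real) set" where
  "C_space L s = {v. (\<forall>j<s. (Dx L ^^ j) v differentiable_on {-L..L}) \<and>
                     (\<forall>j\<le>s. continuous_on {-L..L} ((Dx L ^^ j) v))}"

definition C_norm :: "real \<Rightarrow> nat \<Rightarrow> (real \<Rightarrow> real) \<Rightarrow> real" where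
  "C_norm L s v = (SUP (j, x) \<in> {..s} \<times> {-L..L}. \<bar>(Dx L ^^ j) v x\<bar>)"

definition C3_0 :: "real \<Rightarrow> (real \<Rightarrow> real) set" where
  "C3_0 L = {w \<in> C_space L 3. w (-L) = 0 \<and> w L = 0 \<and>
                              (Dx L ^^ 2) w (-L) = 0 \<and> (Dx L ^^ 2) w L = 0}"

definition C2_tilde_0 :: "real \<Rightarrow> (real \<Rightarrow> real) set" where
  "C2_tilde_0 L = {v \<in> C_space L 2. Dx L v (-L) = 0 \<and> Dx L v L = 0}"


definition test_function :: "real \<Rightarrow> (real \<Rightarrow> real) \<Rightarrow> bool" where
  "test_function L \<phi> \<longleftrightarrow> (\<forall>n x. (deriv ^^ n) \<phi> differentiable (at x)) \<and>
                       (\<exists>r<L. \<forall>x. \<phi> x \<noteq> 0 \<longrightarrow> \<bar>x\<bar> \<le> r)"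

definition L2_function :: "real \<Rightarrow> (real \<Rightarrow> real) \<Rightarrow> bool" where
  "L2_function L f \<longleftrightarrow> f \<in> borel_measurable (lebesgue_on {-L<..<L}) \<and>
                      integrable (lebesgue_on {-L<..<L}) (\<lambda>x. (f x)\<^sup>2)"

definition is_weak_deriv :: "real \<Rightarrow> nat \<Rightarrow> (real \<Rightarrow> real) \<Rightarrow> (real \<Rightarrow> real) \<Rightarrow> bool" where
  "is_weak_deriv L j v g \<longleftrightarrow> (\<forall>\<phi>. test_function L \<phi> \<longrightarrow>
     (LINT x|lebesgue_on {-L<..<L}. v x * (deriv ^^ j) \<phi> x)
       = (-1) ^ j * (LINT x|lebesgue_on {-L<..<L}. g x * \<phi> x))"

text \<open>For \<open>s \<ge> 1\<close> an element of \<open>H\<^sup>s\<close> is represented by its unique continuous version on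
  \<open>[-L,L]\<close>, so that the boundary values in \<open>H\<^sup>1\<^sub>0\<close> are point values. (For \<open>s = 0\<close> nothing is
  demanded beyond square integrability.)\<close>

definition H_space :: "real \<Rightarrow> nat \<Rightarrow> (real \<Rightarrow> real) set" where
  "H_space L s = {v. L2_function L v \<and> (0 < s \<longrightarrow> continuous_on {-L..L} v) \<and>
                     (\<forall>j\<le>s. \<exists>g. L2_function L g \<and> is_weak_deriv L j v g)}"

text \<open>The weak derivative is only determined almost everywhere; the norm below does not depend
  on the choice.\<close>

definition weak_deriv :: "real \<Rightarrow> nat \<Rightarrow> (real \<Rightarrow> real) \<Rightarrow> real \<Rightarrow> real" where
  "weak_deriv L j v = (SOME g. L2_function L g \<and> is_weak_deriv L j v g)"

definition H_norm :: "real \<Rightarrow> nat \<Rightarrow> (real \<Rightarrow> real) \<Rightarrow> real" where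
  "H_norm L s v = sqrt (\<Sum>j\<le>s. LINT x|lebesgue_on {-L<..<L}. (weak_deriv L j v x)\<^sup>2)"

definition H1_0 :: "real \<Rightarrow> (real \<Rightarrow> real) set" where
  "H1_0 L = {v \<in> H_space L 1. v L = 0 \<and> v (-L) = 0}"


definition C_time ::
  "real \<Rightarrow> (real \<Rightarrow> real) set \<Rightarrow> ((real \<Rightarrow> real) \<Rightarrow> real) \<Rightarrow> (real \<Rightarrow> real \<Rightarrow> real) set" where
  "C_time T X nrm = {v. \<forall>t\<in>{0..T}. v t \<in> X \<and>
     ((\<lambda>\<tau>. nrm (\<lambda>x. v \<tau> x - v t x)) \<longlongrightarrow> 0) (at t within {0..T})}"

definition H1_T :: "real \<Rightarrow> real \<Rightarrow> (real \<Rightarrow> real \<Rightarrow> real) set" where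
  "H1_T L T = C_time T (H_space L 1) (H_norm L 1)"

definition H2_T :: "real \<Rightarrow> real \<Rightarrow> (real \<Rightarrow> real \<Rightarrow> real) set" where
  "H2_T L T = C_time T (H_space L 2 \<inter> H1_0 L) (H_norm L 2)"


text \<open>Both Green's functions have the same form: \<open>\<omega>\<^sub>1(x) = h((L+x)/\<surd>c)\<close>, \<open>\<omega>\<^sub>2(x) = h((L-x)/\<surd>c)\<close>
  with \<open>h = cosh\<close>, \<open>c = b\<close> for \<open>F\<close> and \<open>h = sinh\<close>, \<open>c = d\<close> for \<open>G\<close>.\<close>

definition green_kernel :: "(real \<Rightarrow> real) \<Rightarrow> real \<Rightarrow> real \<Rightarrow> real \<Rightarrow> real \<Rightarrow> real" where
  "green_kernel h c L x \<xi> =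
     (let \<omega>\<^sub>1 = (\<lambda>y. h ((L + y) / sqrt c));
          \<omega>\<^sub>2 = (\<lambda>y. h ((L - y) / sqrt c));
          W = - (1 / sqrt c) * sinh (2 * L / sqrt c)
      in - (1 / (c * W)) * (if \<xi> \<le> x then \<omega>\<^sub>1 \<xi> * \<omega>\<^sub>2 x else \<omega>\<^sub>1 x * \<omega>\<^sub>2 \<xi>))"

text \<open>The kernel has a kink at \<open>\<xi> = x\<close>; the junk value of its \<open>\<xi>\<close>-derivative at this single
  point does not affect the integral.\<close>

definition green_operator ::
  "(real \<Rightarrow> real \<Rightarrow> real) \<Rightarrow> real \<Rightarrow> (real \<Rightarrow> real) \<Rightarrow> real \<Rightarrow> real" where
  "green_operator K L f x = (LINT \<xi>|lebesgue_on {-L..L}. deriv (\<lambda>\<zeta>. K x \<zeta>) \<xi> * f \<xi>)"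

definition L_N :: "real \<Rightarrow> real \<Rightarrow> (real \<Rightarrow> real) \<Rightarrow> real \<Rightarrow> real" where
  "L_N b L = green_operator (green_kernel cosh b L) L"

definition L_D :: "real \<Rightarrow> real \<Rightarrow> (real \<Rightarrow> real) \<Rightarrow> real \<Rightarrow> real" where
  "L_D d L = green_operator (green_kernel sinh d L) L"

text \<open>The continuous version of an \<open>H\<^sup>2\<close> function is continuously differentiable on \<open>[-L,L]\<close>, so
  \<open>u\<^sub>x\<close> is a pointwise derivative here.\<close>

definition integral_system_solution ::
  "real \<Rightarrow> real \<Rightarrow> real \<Rightarrow> real \<Rightarrow> real \<Rightarrow> (real \<Rightarrow> real) \<Rightarrow> (real \<Rightarrow> real) \<Rightarrow>
   (real \<Rightarrow> real \<Rightarrow> real) \<Rightarrow> (real \<Rightarrow> real \<Rightarrow> real) \<Rightarrow> bool" where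
  "integral_system_solution a b d L T \<eta>\<^sub>0 u\<^sub>0 \<eta> u \<longleftrightarrow>
     (\<forall>t\<in>{0..T}. \<forall>x\<in>{-L..L}.
        \<eta> t x = \<eta>\<^sub>0 x + (LINT \<tau>|lebesgue_on {0..t}.
                    L_N b L (\<lambda>y. (a + b) / b * u \<tau> y + \<eta> \<tau> y * u \<tau> y) x
                    + a / b * Dx L (u \<tau>) x) \<and>
        u t x = u\<^sub>0 x + (LINT \<tau>|lebesgue_on {0..t}.
                    L_D d L (\<lambda>y. \<eta> \<tau> y + 1 / 2 * (u \<tau> y)\<^sup>2) x))"

text \<open>The conditions on differentiability say that every derivative in the equations exists, as
  \<open>vector_derivative\<close> is total. Time derivatives are required up to the boundary in \<open>x\<close>, so that
  \<open>\<eta>\<^sub>t\<close> and \<open>u\<^sub>t\<close> are functions on \<open>[-L,L]\<close>.\<close>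

definition ibvp_solution ::
  "real \<Rightarrow> real \<Rightarrow> real \<Rightarrow> real \<Rightarrow> real \<Rightarrow> (real \<Rightarrow> real) \<Rightarrow> (real \<Rightarrow> real) \<Rightarrow>
   (real \<Rightarrow> real \<Rightarrow> real) \<Rightarrow> (real \<Rightarrow> real \<Rightarrow> real) \<Rightarrow> bool" where
  "ibvp_solution a b d L T \<eta>\<^sub>0 u\<^sub>0 \<eta> u \<longleftrightarrow>
     (\<forall>t\<in>{0..T}. \<forall>x\<in>{-L..L}.
        (\<lambda>\<tau>. \<eta> \<tau> x) differentiable (at t within {0..T}) \<and>
        (\<lambda>\<tau>. u \<tau> x) differentiable (at t within {0..T})) \<and>
     (\<forall>t\<in>{0..T}. \<forall>x\<in>{-L<..<L}.
        (\<forall>j<2. (Dx L ^^ j) (\<eta> t) differentiable (at x within {-L..L})) \<and>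
        (\<forall>j<3. (Dx L ^^ j) (u t) differentiable (at x within {-L..L})) \<and>
        (\<lambda>\<tau>. (Dx L ^^ 2) (\<eta> \<tau>) x) differentiable (at t within {0..T}) \<and>
        (\<lambda>\<tau>. (Dx L ^^ 2) (u \<tau>) x) differentiable (at t within {0..T}) \<and>
        Dt T \<eta> t x + Dx L (u t) x + Dx L (\<lambda>y. \<eta> t y * u t y) x + a * (Dx L ^^ 3) (u t) x
          - b * Dt T (\<lambda>\<tau>. (Dx L ^^ 2) (\<eta> \<tau>)) t x = 0 \<and>
        Dt T u t x + Dx L (\<eta> t) x + u t x * Dx L (u t) x
          - d * Dt T (\<lambda>\<tau>. (Dx L ^^ 2) (u \<tau>)) t x = 0) \<and>
     (\<forall>x\<in>{-L..L}. \<eta> 0 x = \<eta>\<^sub>0 x \<and> u 0 x = u\<^sub>0 x) \<and>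
     (\<forall>t\<in>{0..T}. u t (-L) = 0 \<and> u t L = 0 \<and>
        (Dx L ^^ 2) (u t) (-L) = 0 \<and> (Dx L ^^ 2) (u t) L = 0)"

end

theory Submission
  imports Defs
begin

text \<open>
  Write \<open>E = (a+b)/b u + \<eta> u\<close> and \<open>\<Phi> = \<eta> + u\<^sup>2/2\<close>. Differentiating the second integral equation
  in \<open>x\<close>, where the jump of the kernel contributes \<open>\<Phi>/d\<close>, shows that for every fixed \<open>x\<close> the pair
  \<open>(\<eta>, u\<^sub>x)\<close> solves
    \<open>\<eta>\<^sub>t = L\<^sub>N E - \<alpha> u\<^sub>x\<close>, \<open>(u\<^sub>x)\<^sub>t = \<delta> \<eta> + s\<close>, with \<open>\<alpha> = -a/b > 0\<close> and \<open>\<delta> = 1/d > 0\<close>.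
  There is no direct gain of regularity, since each unknown enters the equation of the other at
  the same order. But \<open>L\<^sub>N E\<close> and \<open>s\<close> are one derivative smoother in \<open>x\<close> than the pair itself, and the
  constant coefficient system is solved by a rotation, so the pair inherits the regularity of
  \<open>L\<^sub>N E\<close>, \<open>s\<close> and the initial data. Applying this twice gives \<open>\<eta> \<in> C\<^sup>2\<close>, \<open>u \<in> C\<^sup>3\<close>. At \<open>x = \<plusminus>L\<close> the system
  for \<open>(\<eta>\<^sub>x, u\<^sub>x\<^sub>x)\<close> is homogeneous with zero data, which preserves the boundary conditions. The
  Sobolev embedding of \<open>H\<^sup>1\<close> into continuous functions starts the argument: it makes \<open>\<eta>\<close> and \<open>u\<close>
  jointly continuous.
\<close>

section \<open>Smooth step functions\<close>

text \<open>Working at finite order makes the closure rules provable by induction on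
  \<open>n\<close>; test functions then ask for every order. What is counted are derivatives that
  are themselves differentiable, so order 0 already means differentiable everywhere.\<close>

definition smooth_upto :: "nat \<Rightarrow> (real \<Rightarrow> real) \<Rightarrow> bool" where
  "smooth_upto n f \<longleftrightarrow> (\<forall>k\<le>n. \<forall>x. (deriv ^^ k) f differentiable (at x))"

lemma smooth_upto_Suc:
  "smooth_upto (Suc n) f \<longleftrightarrow> (\<forall>x. f differentiable (at x)) \<and> smooth_upto n (deriv f)"
proof -
  have "smooth_upto (Suc n) f \<longleftrightarrow>
      (\<forall>x. f differentiable (at x)) \<and> (\<forall>k\<le>n. \<forall>x. (deriv ^^ Suc k) f differentiable (at x))"
    unfolding smooth_upto_def
    by (metis funpow_0 Suc_le_mono not0_implies_Suc zero_le)
  then show ?thesis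
    by (simp add: smooth_upto_def funpow_Suc_right del: funpow.simps)
qed

lemma smooth_upto_0: "smooth_upto 0 f \<longleftrightarrow> (\<forall>x. f differentiable (at x))"
  by (simp add: smooth_upto_def)

lemma smooth_upto_mono: "smooth_upto n f \<Longrightarrow> m \<le> n \<Longrightarrow> smooth_upto m f"
  by (auto simp: smooth_upto_def)

lemma smooth_upto_deriv_eq:
  assumes "\<And>x. (f has_real_derivative f' x) (at x)"
  shows "smooth_upto (Suc n) f \<longleftrightarrow> smooth_upto n f'"
proof -
  have "deriv f = f'"
    using assms DERIV_imp_deriv by blast
  moreover have "f differentiable (at x)" for x
    using assms[of x] real_differentiable_def by blast
  ultimately show ?thesis
    by (simp add: smooth_upto_Suc)
qed

lemma smooth_upto_0I:
  assumes "\<And>x. (f has_real_derivative f' x) (at x)"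
  shows "smooth_upto 0 f"
  using assms real_differentiable_def unfolding smooth_upto_0 by blast

lemma smooth_upto_DERIV:
  "smooth_upto n f \<Longrightarrow> (f has_real_derivative deriv f x) (at x)"
  using smooth_upto_0 smooth_upto_mono DERIV_deriv_iff_real_differentiable by blast

lemma smooth_upto_const: "smooth_upto n (\<lambda>x. c)"
proof (induction n arbitrary: c)
  case 0
  show ?case by (simp add: smooth_upto_0)
next
  case (Suc n)
  then show ?case by (subst smooth_upto_deriv_eq[where f'="\<lambda>x. 0"]) auto
qed

lemma smooth_upto_add:
  "smooth_upto n f \<Longrightarrow> smooth_upto n g \<Longrightarrow> smooth_upto n (\<lambda>x. f x + g x)"
proof (induction n arbitrary: f g)
  case 0
  then show ?case by (simp add: smooth_upto_0)
next
  case (Suc n)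
  have "((\<lambda>x. f x + g x) has_real_derivative deriv f x + deriv g x) (at x)" for x
    by (intro DERIV_add smooth_upto_DERIV[OF Suc.prems(1)] smooth_upto_DERIV[OF Suc.prems(2)])
  then show ?case
    using Suc by (subst smooth_upto_deriv_eq) (auto simp: smooth_upto_Suc)
qed

lemma smooth_upto_mult:
  "smooth_upto n f \<Longrightarrow> smooth_upto n g \<Longrightarrow> smooth_upto n (\<lambda>x. f x * g x)"
proof (induction n arbitrary: f g)
  case 0
  then show ?case by (simp add: smooth_upto_0)
next
  case (Suc n)
  have d: "((\<lambda>x. f x * g x) has_real_derivative deriv f x * g x + deriv g x * f x) (at x)" for x
    by (intro DERIV_mult smooth_upto_DERIV[OF Suc.prems(1)] smooth_upto_DERIV[OF Suc.prems(2)])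
  have "smooth_upto n f" "smooth_upto n g" "smooth_upto n (deriv f)" "smooth_upto n (deriv g)"
    using Suc.prems smooth_upto_mono[of "Suc n" _ n] by (auto simp: smooth_upto_Suc)
  then show ?case
    unfolding smooth_upto_deriv_eq[OF d] by (intro smooth_upto_add Suc.IH)
qed

lemma smooth_upto_diff:
  assumes "smooth_upto n f" "smooth_upto n g"
  shows "smooth_upto n (\<lambda>x. f x - g x)"
  using smooth_upto_add[OF assms(1) smooth_upto_mult[OF smooth_upto_const[of n "-1"] assms(2)]]
  by simp

text \<open>The derivative is a product of copies of the inverse and of \<open>deriv f\<close>, so
  at order \<open>n\<close> every factor is covered by the induction hypothesis and the product
  rule.\<close>

lemma smooth_upto_inverse:
  "smooth_upto n f \<Longrightarrow> (\<And>x. f x \<noteq> 0) \<Longrightarrow> smooth_upto n (\<lambda>x. inverse (f x))"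
proof (induction n arbitrary: f)
  case 0
  then show ?case by (simp add: smooth_upto_0)
next
  case (Suc n)
  have d: "((\<lambda>x. inverse (f x)) has_real_derivative
        0 - inverse (f x) * inverse (f x) * deriv f x) (at x)" for x
    using DERIV_inverse'[OF smooth_upto_DERIV[OF Suc.prems(1)] Suc.prems(2)]
    by (simp add: algebra_simps)
  have "smooth_upto n f" "smooth_upto n (deriv f)"
    using Suc.prems smooth_upto_mono[of "Suc n" _ n] by (auto simp: smooth_upto_Suc)
  then show ?case
    unfolding smooth_upto_deriv_eq[OF d]
    by (intro smooth_upto_diff smooth_upto_const smooth_upto_mult Suc.IH Suc.prems)
qed

lemma smooth_upto_affine: "smooth_upto n f \<Longrightarrow> smooth_upto n (\<lambda>x. f (m * x + c))"
proof (induction n arbitrary: f)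
  case 0
  have "((\<lambda>x. f (m * x + c)) has_real_derivative deriv f (m * x + c) * m) (at x)" for x
    by (rule DERIV_chain2[OF smooth_upto_DERIV[OF 0]]) (auto intro!: derivative_eq_intros)
  then show ?case by (rule smooth_upto_0I)
next
  case (Suc n)
  have d: "((\<lambda>x. f (m * x + c)) has_real_derivative deriv f (m * x + c) * m) (at x)" for x
    by (rule DERIV_chain2[OF smooth_upto_DERIV[OF Suc.prems]]) (auto intro!: derivative_eq_intros)
  show ?case
    unfolding smooth_upto_deriv_eq[OF d] using Suc
    by (intro smooth_upto_mult smooth_upto_const) (auto simp: smooth_upto_Suc)
qed

text \<open>The classical exp(-1/x) extended by zero, with an additional factor x^(-k). The index
  \<open>k\<close> closes the family under differentiation, so one derivative formula yields
  smoothness of every order.\<close>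

definition flat_exp :: "nat \<Rightarrow> real \<Rightarrow> real" where
  "flat_exp k x = (if 0 < x then (1 / x) ^ k * exp (- (1 / x)) else 0)"

text \<open>With y = 1/x the right limit is the decay of y^k / exp y at infinity; to the left of 0
  the function is zero.\<close>

lemma flat_exp_tendsto_0: "(flat_exp k \<longlongrightarrow> 0) (at 0)"
proof -
  have "((\<lambda>x. inverse x ^ k / exp (inverse x)) \<longlongrightarrow> 0) (at_right (0::real))"
    using filterlim_compose[OF tendsto_power_div_exp_0 filterlim_inverse_at_top_right] .
  then have "(flat_exp k \<longlongrightarrow> 0) (at_right 0)"
    by (rule Lim_transform_eventually)
      (auto simp: eventually_at_filter flat_exp_def exp_minus field_simps)
  moreover have "(flat_exp k \<longlongrightarrow> 0) (at_left 0)"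
    by (rule tendsto_eventually) (auto simp: eventually_at_filter flat_exp_def)
  ultimately show ?thesis
    by (simp add: filterlim_split_at_real)
qed

lemma flat_exp_DERIV:
  "(flat_exp k has_real_derivative flat_exp (k + 2) x - real k * flat_exp (k + 1) x) (at x)"
proof (cases x "0::real" rule: linorder_cases)
  case less
  have "((\<lambda>x. 0) has_real_derivative 0) (at x)" by simp
  then have "(flat_exp k has_real_derivative 0) (at x)"
    by (rule has_field_derivative_transform_within_open[where S="{..<0}"])
      (use less in \<open>auto simp: flat_exp_def\<close>)
  then show ?thesis using less by (simp add: flat_exp_def)
next
  case equal
  \<comment> \<open>The difference quotient at 0 is the next member of the family, whose limit at 0
    is known.\<close>
  have "flat_exp k h / h = flat_exp (k + 1) h" for h
    by (simp add: flat_exp_def)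
  then have "((\<lambda>h. (flat_exp k h - flat_exp k 0) / (h - 0)) \<longlongrightarrow> 0) (at 0)"
    using flat_exp_tendsto_0[of "k + 1"] by (simp add: flat_exp_def[of k 0])
  then have "(flat_exp k has_real_derivative 0) (at 0)"
    by (simp add: has_field_derivative_iff)
  then show ?thesis using equal by (simp add: flat_exp_def)
next
  case greater
  \<comment> \<open>The power rule produces the exponent \<open>k - 1\<close>, truncated at
    \<open>k = 0\<close>; hence the case distinction on \<open>k\<close>.\<close>
  have "((\<lambda>x. (1 / x) ^ k * exp (- (1 / x))) has_real_derivative
      (1 / x) ^ (k + 2) * exp (- (1 / x)) - real k * ((1 / x) ^ (k + 1) * exp (- (1 / x)))) (at x)"
    using greater
    by (cases k)
      (auto intro!: derivative_eq_intros simp: field_simps power2_eq_square,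
       metis One_nat_def mult.commute neq0_conv power_minus_mult)
  then have "(flat_exp k has_real_derivative
      (1 / x) ^ (k + 2) * exp (- (1 / x)) - real k * ((1 / x) ^ (k + 1) * exp (- (1 / x)))) (at x)"
    by (rule has_field_derivative_transform_within_open[where S="{0<..}"])
      (use greater in \<open>auto simp: flat_exp_def\<close>)
  then show ?thesis using greater by (simp add: flat_exp_def)
qed

lemma smooth_upto_flat_exp: "smooth_upto n (flat_exp k)"
proof (induction n arbitrary: k)
  case 0
  show ?case by (rule smooth_upto_0I[OF flat_exp_DERIV])
next
  case (Suc n)
  show ?case
    unfolding smooth_upto_deriv_eq[OF flat_exp_DERIV]
    by (intro smooth_upto_diff smooth_upto_mult smooth_upto_const Suc)
qed

lemma flat_exp_mono: "x \<le> y \<Longrightarrow> flat_exp 0 x \<le> flat_exp 0 y"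
  by (auto simp: flat_exp_def field_simps)

text \<open>Two uses: the derivative of a step is a nonnegative bump by which functions are
  averaged, and the difference of two steps is a compactly supported function whose derivative
  compares two such averages.\<close>

definition smooth_step :: "real \<Rightarrow> real \<Rightarrow> (real \<Rightarrow> real) \<Rightarrow> bool" where
  "smooth_step p q S \<longleftrightarrow>
     (\<forall>n. smooth_upto n S) \<and> (\<forall>z\<le>p. S z = 0) \<and> (\<forall>z\<ge>q. S z = 1) \<and> mono S"

text \<open>The quotient N / (N + M) works, where N is flat to the left of \<open>p\<close> and M is
  flat to the right of \<open>q\<close>. Since \<open>p < q\<close>, the two never vanish together
  and the denominator stays positive.\<close>

lemma smooth_step_exists:
  fixes p q :: real
  assumes "p < q"
  shows "\<exists>S. smooth_step p q S"
proof -
  define N where "N z = flat_exp 0 (z - p)" for z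
  define M where "M z = flat_exp 0 (q - z)" for z
  have pos: "0 \<le> N z" "0 \<le> M z" "0 < N z + M z" for z
    using assms by (auto simp: N_def M_def flat_exp_def add_pos_nonneg add_nonneg_pos)
  have sN: "smooth_upto n N" for n
    using smooth_upto_affine[OF smooth_upto_flat_exp, of n 0 1 "-p"] by (simp add: N_def[abs_def])
  have sM: "smooth_upto n M" for n
    using smooth_upto_affine[OF smooth_upto_flat_exp, of n 0 "-1" q]
    by (simp add: M_def[abs_def] algebra_simps)
  show ?thesis
    unfolding smooth_step_def
  proof (intro exI[of _ "\<lambda>z. N z * inverse (N z + M z)"] conjI allI impI)
    show "smooth_upto n (\<lambda>z. N z * inverse (N z + M z))" for n
      using pos(3) by (intro smooth_upto_mult smooth_upto_inverse smooth_upto_add sN sM)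
        (metis less_irrefl)
    show "N z * inverse (N z + M z) = 0" if "z \<le> p" for z
      using that by (simp add: N_def flat_exp_def)
    show "N z * inverse (N z + M z) = 1" if "q \<le> z" for z
    proof -
      have "M z = 0" using that by (simp add: M_def flat_exp_def)
      then show ?thesis using pos(3)[of z] by simp
    qed
    show "mono (\<lambda>z. N z * inverse (N z + M z))"
    proof (rule monoI)
      fix x y :: real
      assume "x \<le> y"
      then have "N x \<le> N y" "M y \<le> M x"
        by (auto simp: N_def M_def intro: flat_exp_mono)
      \<comment> \<open>Monotonicity of the quotient is exactly this inequality after the
        denominators are cleared.\<close>
      then have "N x * M y \<le> N y * M x"
        using pos by (intro mult_mono) auto
      then show "N x * inverse (N x + M x) \<le> N y * inverse (N y + M y)"
        using pos(3)[of x] pos(3)[of y] by (simp add: field_simps)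
    qed
  qed
qed

section \<open>Sobolev embedding\<close>

lemma finite_measure_lebesgue_on_interval: "finite_measure (lebesgue_on {-L<..<(L::real)})"
proof (rule finite_measure_lebesgue_on)
  show "{-L<..<L} \<in> lmeasurable"
    using lmeasurable_box[of "-L" L] by simp
qed

lemma L2_function_integrable:
  assumes "L2_function L f"
  shows "integrable (lebesgue_on {-L<..<L}) f"
proof -
  interpret finite_measure "lebesgue_on {-L<..<L}"
    by (rule finite_measure_lebesgue_on_interval)
  show ?thesis
    using assms square_integrable_imp_integrable unfolding L2_function_def by blast
qed

lemma L2_function_diff:
  assumes "L2_function L f" "L2_function L g"
  shows "L2_function L (\<lambda>x. f x - g x)"
proof -
  have m: "f \<in> borel_measurable (lebesgue_on {-L<..<L})" "g \<in> borel_measurable (lebesgue_on {-L<..<L})"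
    using assms by (auto simp: L2_function_def)
  have "integrable (lebesgue_on {-L<..<L}) (\<lambda>x. 2 * (f x)\<^sup>2 + 2 * (g x)\<^sup>2)"
    using assms by (auto simp: L2_function_def)
  then have "integrable (lebesgue_on {-L<..<L}) (\<lambda>x. (f x - g x)\<^sup>2)"
  proof (rule Bochner_Integration.integrable_bound)
    show "AE x in lebesgue_on {-L<..<L}. norm ((f x - g x)\<^sup>2) \<le> norm (2 * (f x)\<^sup>2 + 2 * (g x)\<^sup>2)"
    proof (intro AE_I2)
      fix x
      have "0 \<le> (f x + g x)\<^sup>2" by simp
      then have "(f x - g x)\<^sup>2 \<le> 2 * (f x)\<^sup>2 + 2 * (g x)\<^sup>2"
        by (simp add: power2_eq_square algebra_simps)
      then show "norm ((f x - g x)\<^sup>2) \<le> norm (2 * (f x)\<^sup>2 + 2 * (g x)\<^sup>2)"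
        by (simp add: abs_of_nonneg)
    qed
  qed (use m in measurable)
  then show ?thesis
    using m by (auto simp: L2_function_def)
qed

lemma test_function_deriv_continuous:
  assumes "test_function L \<phi>"
  shows "continuous_on A ((deriv ^^ j) \<phi>)"
  using assms unfolding test_function_def
  by (meson continuous_at_imp_continuous_on differentiable_imp_continuous_within)

lemma integrable_mult_continuous:
  fixes g \<psi> :: "real \<Rightarrow> real"
  assumes "integrable (lebesgue_on {-L<..<L}) g" "continuous_on {-L..L} \<psi>"
  shows "integrable (lebesgue_on {-L<..<L}) (\<lambda>x. g x * \<psi> x)"
proof -
  have "bounded (\<psi> ` {-L..L})"
    using assms(2) by (intro compact_imp_bounded compact_continuous_image) auto
  then obtain B where B: "\<And>x. x \<in> {-L..L} \<Longrightarrow> \<bar>\<psi> x\<bar> \<le> B"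
    unfolding bounded_iff by fastforce
  have m: "\<psi> \<in> borel_measurable (lebesgue_on {-L<..<L})"
    by (rule continuous_imp_measurable_on_sets_lebesgue)
      (auto intro: continuous_on_subset[OF assms(2)])
  have "integrable (lebesgue_on {-L<..<L}) (\<lambda>x. B * g x)"
    using assms(1) by simp
  then show ?thesis
  proof (rule Bochner_Integration.integrable_bound)
    show "AE x in lebesgue_on {-L<..<L}. norm (g x * \<psi> x) \<le> norm (B * g x)"
    proof (rule AE_I2)
      fix x assume "x \<in> space (lebesgue_on {-L<..<L})"
      then have "\<bar>\<psi> x\<bar> \<le> \<bar>B\<bar>" using B[of x] by auto
      then show "norm (g x * \<psi> x) \<le> norm (B * g x)"
        by (simp add: abs_mult mult.commute mult_right_mono)
    qed
  qed (use m assms(1) in measurable)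
qed

lemma is_weak_deriv_diff:
  assumes "L2_function L v" "L2_function L w" "L2_function L g" "L2_function L h"
    and "is_weak_deriv L j v g" "is_weak_deriv L j w h"
  shows "is_weak_deriv L j (\<lambda>x. v x - w x) (\<lambda>x. g x - h x)"
  unfolding is_weak_deriv_def
proof (intro allI impI)
  fix \<phi> assume \<phi>: "test_function L \<phi>"
  note int = integrable_mult_continuous[OF L2_function_integrable test_function_deriv_continuous[OF \<phi>]]
  have int0: "integrable (lebesgue_on {-L<..<L}) (\<lambda>x. k x * \<phi> x)" if "L2_function L k" for k
    using int[OF that, of 0] by simp
  show "(LINT x|lebesgue_on {-L<..<L}. (v x - w x) * (deriv ^^ j) \<phi> x) =
      (-1) ^ j * (LINT x|lebesgue_on {-L<..<L}. (g x - h x) * \<phi> x)"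
    using assms \<phi>
    by (simp add: left_diff_distrib int int0 is_weak_deriv_def right_diff_distrib)
qed

lemma H_space_diff:
  assumes "v \<in> H_space L s" "w \<in> H_space L s"
  shows "(\<lambda>x. v x - w x) \<in> H_space L s"
proof -
  have "\<exists>g. L2_function L g \<and> is_weak_deriv L j (\<lambda>x. v x - w x) g" if "j \<le> s" for j
  proof -
    from assms that obtain g h where
      "L2_function L g" "is_weak_deriv L j v g" "L2_function L h" "is_weak_deriv L j w h"
      unfolding H_space_def by blast
    moreover have "L2_function L v" "L2_function L w"
      using assms by (auto simp: H_space_def)
    ultimately show ?thesis
      by (intro exI[of _ "\<lambda>x. g x - h x"] conjI L2_function_diff is_weak_deriv_diff)
  qed
  then show ?thesis
    using assms by (auto simp: H_space_def intro!: L2_function_diff continuous_on_diff)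
qed

lemma weak_deriv_spec:
  assumes "v \<in> H_space L s" "j \<le> s"
  shows "L2_function L (weak_deriv L j v)" "is_weak_deriv L j v (weak_deriv L j v)"
proof -
  have "\<exists>g. L2_function L g \<and> is_weak_deriv L j v g"
    using assms by (auto simp: H_space_def)
  then have "L2_function L (weak_deriv L j v) \<and> is_weak_deriv L j v (weak_deriv L j v)"
    unfolding weak_deriv_def by (rule someI_ex)
  then show "L2_function L (weak_deriv L j v)" "is_weak_deriv L j v (weak_deriv L j v)"
    by auto
qed

text \<open>A form of Cauchy-Schwarz on an interval of length 2L, obtained by integrating the Young
  inequality |g| \<le> l/2 + g^2/(2l) and choosing the free parameter l afterwards.\<close>

lemma weak_deriv_L1_le_H_norm:
  assumes "v \<in> H_space L s" "j \<le> s" "L > 0"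
  shows "(LINT x|lebesgue_on {-L<..<L}. \<bar>weak_deriv L j v x\<bar>) \<le> (L + 1) * H_norm L s v"
proof -
  define g where "g = weak_deriv L j v"
  define N where "N = (LINT x|lebesgue_on {-L<..<L}. \<bar>g x\<bar>)"
  define I where "I = (LINT x|lebesgue_on {-L<..<L}. (g x)\<^sup>2)"
  define H where "H = H_norm L s v"
  have g: "L2_function L g"
    using weak_deriv_spec[OF assms(1,2)] by (simp add: g_def)
  have int: "integrable (lebesgue_on {-L<..<L}) g" "integrable (lebesgue_on {-L<..<L}) (\<lambda>x. (g x)\<^sup>2)"
    using L2_function_integrable[OF g] g by (auto simp: L2_function_def)
  have "I \<le> (\<Sum>j\<le>s. LINT x|lebesgue_on {-L<..<L}. (weak_deriv L j v x)\<^sup>2)"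
    unfolding I_def g_def using assms(2)
    by (intro member_le_sum) (auto intro: Bochner_Integration.integral_nonneg)
  moreover have "0 \<le> I" unfolding I_def by simp
  ultimately have H: "I \<le> H\<^sup>2" "0 \<le> H"
    by (auto simp: H_def H_norm_def real_sqrt_pow2 sum_nonneg)
  have const: "integrable (lebesgue_on {-L<..<L}) (\<lambda>x. c)" "(LINT x|lebesgue_on {-L<..<L}. c) = 2 * L * c"
    for c :: real
    using assms(3) finite_measure.integrable_const[OF finite_measure_lebesgue_on_interval]
    by (auto simp: measure_restrict_space)
  have le: "N \<le> L * l + I / (2 * l)" if "l > 0" for l
  proof -
    have "\<bar>g x\<bar> \<le> l / 2 + (g x)\<^sup>2 / (2 * l)" for x
    proof -
      have "0 \<le> (\<bar>g x\<bar> - l)\<^sup>2" by simp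
      also have "\<dots> = (g x)\<^sup>2 - 2 * l * \<bar>g x\<bar> + l * l" by (simp add: power2_eq_square algebra_simps)
      finally show ?thesis using that by (simp add: field_simps)
    qed
    then have "N \<le> (LINT x|lebesgue_on {-L<..<L}. l / 2 + (g x)\<^sup>2 / (2 * l))"
      unfolding N_def using int const by (intro integral_mono) auto
    also have "\<dots> = L * l + I / (2 * l)"
      using int const(1) assms(3) by (simp add: I_def measure_restrict_space)
    finally show ?thesis .
  qed
  have "N \<le> (L + 1) * H"
  proof (cases "H = 0")
    case True
    then have "I = 0" using H \<open>0 \<le> I\<close> by simp
    then have "N / L \<le> 0 + l" if "l > 0" for l
      using le[OF that] assms(3) by (simp add: field_simps)
    then have "N / L \<le> 0" by (rule field_le_epsilon)
    then show ?thesis using True assms(3) by (simp add: divide_le_0_iff)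
  next
    case False
    then have "N \<le> L * H + I / (2 * H)" using H by (intro le) auto
    also have "I / (2 * H) \<le> H / 2"
      using H False by (simp add: field_simps power2_eq_square)
    finally show ?thesis using H by (simp add: algebra_simps)
  qed
  then show ?thesis by (simp add: N_def g_def H_def)
qed

lemma integrable_lebesgue_on_open_continuous:
  fixes f :: "real \<Rightarrow> real"
  assumes "continuous_on {-L..L} f"
  shows "integrable (lebesgue_on {-L<..<L}) f"
    and "(LINT x|lebesgue_on {-L<..<L}. f x) = integral {-L..L} f"
proof -
  have "f absolutely_integrable_on {-L..L}"
    by (rule absolutely_integrable_continuous_real[OF assms])
  then have "f absolutely_integrable_on {-L<..<L}"
    by (rule set_integrable_subset) auto
  then show int: "integrable (lebesgue_on {-L<..<L}) f"
    by (simp add: absolutely_integrable_on_def integrable_restrict_space set_integrable_def)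
  show "(LINT x|lebesgue_on {-L<..<L}. f x) = integral {-L..L} f"
    using lebesgue_integral_eq_integral[OF int] integral_open_interval_real[of "-L" L f] by simp
qed

section \<open>Averaging against the derivative of a step\<close>

lemma test_function_of_smooth:
  assumes "\<And>n. smooth_upto n \<phi>" "r < L" "\<And>x. \<phi> x \<noteq> 0 \<Longrightarrow> \<bar>x\<bar> \<le> r"
  shows "test_function L \<phi>"
  using assms unfolding test_function_def smooth_upto_def by blast

context
  fixes S :: "real \<Rightarrow> real" and p q :: real
  assumes step: "smooth_step p q S"
begin

lemma
  shows step_smooth: "smooth_upto n S"
    and step_left: "z \<le> p \<Longrightarrow> S z = 0" and step_right: "q \<le> z \<Longrightarrow> S z = 1"
    and step_mono: "mono S"
  using step by (auto simp: smooth_step_def)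

lemma step_deriv_nonneg: "0 \<le> deriv S x"
  by (rule mono_on_imp_deriv_nonneg[where A=UNIV, OF _ smooth_upto_DERIV[OF step_smooth]])
    (use step_mono in \<open>auto simp: mono_imp_mono_on\<close>)

lemma step_deriv_eq_0:
  assumes "x \<notin> {p..q}"
  shows "deriv S x = 0"
proof (rule DERIV_imp_deriv)
  consider "x < p" | "q < x" using assms by fastforce
  then show "(S has_real_derivative 0) (at x)"
  proof cases
    case 1
    show ?thesis
      by (rule has_field_derivative_transform_within_open[OF DERIV_const[of 0], where S="{..<p}"])
        (use 1 step_left in auto)
  next
    case 2
    show ?thesis
      by (rule has_field_derivative_transform_within_open[OF DERIV_const[of 1], where S="{q<..}"])
        (use 2 step_right in auto)
  qed
qed

lemma step_range: "0 \<le> S x" "S x \<le> 1"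
  using monoD[OF step_mono, of "min p x" x] monoD[OF step_mono, of x "max q x"] step_left[of "min p x"] step_right[of "max q x"]
  by auto

lemma step_deriv_continuous: "continuous_on A (deriv S)"
proof (intro continuous_at_imp_continuous_on ballI)
  fix x
  have "smooth_upto 0 (deriv S)"
    using step_smooth[of 1] smooth_upto_Suc[of 0 S] by simp
  then show "isCont (deriv S) x"
    by (intro DERIV_isCont[OF smooth_upto_DERIV])
qed

lemma step_deriv_test_function:
  assumes "-L < p" "p < q" "q < L"
  shows "test_function L (deriv S)"
proof (rule test_function_of_smooth)
  show "smooth_upto n (deriv S)" for n
    using step_smooth[of "Suc n"] smooth_upto_Suc by blast
  show "max \<bar>p\<bar> \<bar>q\<bar> < L"
    using assms by auto
  show "\<bar>x\<bar> \<le> max \<bar>p\<bar> \<bar>q\<bar>" if "deriv S x \<noteq> 0" for x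
  proof -
    have "x \<in> {p..q}" using step_deriv_eq_0 that by blast
    then show ?thesis by auto
  qed
qed

text \<open>Inside the interval \<open>deriv S\<close> is a probability density: it is nonnegative,
  vanishes off [p, q] and has integral S L - S (-L) = 1. Pairing with it therefore averages the
  values of \<open>v\<close> on [p, q].\<close>

lemma step_deriv_average:
  assumes "-L < p" "p < q" "q < L" and v: "continuous_on {-L..L} v"
    and close: "\<And>z. z \<in> {p..q} \<Longrightarrow> \<bar>v z - c\<bar> \<le> e"
  shows "\<bar>(LINT x|lebesgue_on {-L<..<L}. v x * deriv S x) - c\<bar> \<le> e"
proof -
  let ?M = "lebesgue_on {-L<..<L}"
  have "(deriv S has_integral (S L - S (-L))) {-L..L}"
    using assms smooth_upto_DERIV[OF step_smooth]
    by (intro fundamental_theorem_of_calculus)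
      (auto simp flip: has_real_derivative_iff_has_vector_derivative intro: DERIV_subset)
  then have one: "(LINT x|?M. deriv S x) = 1"
    using integrable_lebesgue_on_open_continuous(2)[OF step_deriv_continuous, of L] assms step_left[of "-L"] step_right[of L]
    by (simp add: integral_unique)
  have int: "integrable ?M (\<lambda>x. deriv S x)" "integrable ?M (\<lambda>x. v x * deriv S x)"
    by (intro integrable_lebesgue_on_open_continuous(1) continuous_on_mult v step_deriv_continuous)+
  have "(LINT x|?M. v x * deriv S x) - c = (LINT x|?M. v x * deriv S x) - (LINT x|?M. c * deriv S x)"
    by (simp add: one)
  also have "\<dots> = (LINT x|?M. v x * deriv S x - c * deriv S x)"
    using int by simp
  finally have eq: "(LINT x|?M. v x * deriv S x) - c = (LINT x|?M. v x * deriv S x - c * deriv S x)" .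
  have "\<bar>LINT x|?M. v x * deriv S x - c * deriv S x\<bar> \<le> (LINT x|?M. \<bar>v x * deriv S x - c * deriv S x\<bar>)"
    by (rule integral_abs_bound)
  also have "\<dots> \<le> (LINT x|?M. e * deriv S x)"
  proof (rule integral_mono)
    fix x
    show "\<bar>v x * deriv S x - c * deriv S x\<bar> \<le> e * deriv S x"
    proof (cases "x \<in> {p..q}")
      case True
      have "\<bar>v x * deriv S x - c * deriv S x\<bar> = \<bar>v x - c\<bar> * deriv S x"
        using step_deriv_nonneg[of x] by (simp add: abs_mult flip: left_diff_distrib)
      then show ?thesis using close[OF True] step_deriv_nonneg[of x] by (simp add: mult_right_mono)
    next
      case False
      then show ?thesis using step_deriv_eq_0 by simp
    qed
  qed (use int in auto)
  also have "\<dots> = e" by (simp add: one)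
  finally show ?thesis by (simp add: eq)
qed

end

text \<open>For \<open>j = 1\<close> this controls the oscillation of \<open>v\<close>, for
  \<open>j = 0\<close> its averages: all derivatives are shifted to the test function, leaving only
  the L1 norm of \<open>g\<close>.\<close>

lemma is_weak_deriv_bound:
  assumes "is_weak_deriv L j v g" "L2_function L g" "test_function L \<phi>" "\<And>x. \<bar>\<phi> x\<bar> \<le> B"
  shows "\<bar>LINT x|lebesgue_on {-L<..<L}. v x * (deriv ^^ j) \<phi> x\<bar>
      \<le> B * (LINT x|lebesgue_on {-L<..<L}. \<bar>g x\<bar>)"
proof -
  let ?M = "lebesgue_on {-L<..<L}"
  note g = L2_function_integrable[OF assms(2)]
  have g\<phi>: "integrable ?M (\<lambda>x. g x * \<phi> x)"
    using integrable_mult_continuous[OF g test_function_deriv_continuous[OF assms(3), of _ 0]] by simp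
  have "\<bar>LINT x|?M. v x * (deriv ^^ j) \<phi> x\<bar> = \<bar>LINT x|?M. g x * \<phi> x\<bar>"
    using assms by (simp add: is_weak_deriv_def abs_mult)
  also have "\<dots> \<le> (LINT x|?M. \<bar>g x * \<phi> x\<bar>)"
    by (rule integral_abs_bound)
  also have "\<dots> \<le> (LINT x|?M. B * \<bar>g x\<bar>)"
    using integrable_abs[OF g] integrable_abs[OF g\<phi>] assms(4)
    by (intro integral_mono) (auto simp: abs_mult mult.commute[of "\<bar>g _\<bar>"] mult_right_mono)
  finally show ?thesis using g by simp
qed

lemma step_near_point:
  assumes "x \<in> {-L<..<L}" "continuous_on {-L..L} v" "0 < (e::real)"
  obtains p q where "-L < p" "p < q" "q < (L::real)" "\<And>z. z \<in> {p..q} \<Longrightarrow> \<bar>v z - v x\<bar> \<le> (e::real)"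
proof -
  have "isCont v x"
    using assms continuous_on_interior[of "{-L..L}" v x] by simp
  then obtain \<delta> where \<delta>: "\<delta> > 0" "\<And>z. \<bar>z - x\<bar> < \<delta> \<Longrightarrow> \<bar>v z - v x\<bar> < e"
    using assms(3) unfolding continuous_at_eps_delta dist_real_def by blast
  \<comment> \<open>Half of the smaller of the continuity radius and the distance to the boundary,
    so that [x - \<mu>, x + \<mu>] stays strictly within both.\<close>
  define \<mu> where "\<mu> = min \<delta> (L - \<bar>x\<bar>) / 2"
  have \<mu>: "0 < \<mu>" "\<mu> < \<delta>" "\<mu> < L - \<bar>x\<bar>"
    using \<delta>(1) assms(1) by (auto simp: \<mu>_def abs_if min_def)
  show ?thesis
  proof (rule that[of "x - \<mu>" "x + \<mu>"])
    show "\<bar>v z - v x\<bar> \<le> e" if "z \<in> {x - \<mu>..x + \<mu>}" for z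
      using \<delta>(2)[of z] that \<mu> by (force simp: abs_le_iff)
  qed (use \<mu> in auto)
qed

text \<open>A substitute for the fundamental theorem of calculus. The test function is the
  difference of two steps that rise near \<open>x\<close> and near \<open>y\<close>; it is bounded
  by 1, and integrating \<open>v\<close> against its derivative gives v x - v y up to a small
  error.\<close>

lemma weak_deriv_oscillation:
  assumes v: "continuous_on {-L..L} v" and g: "L2_function L g" "is_weak_deriv L 1 v g"
    and xy: "x \<in> {-L<..<L}" "y \<in> {-L<..<L}"
  shows "\<bar>v x - v y\<bar> \<le> (LINT x|lebesgue_on {-L<..<L}. \<bar>g x\<bar>)"
proof (rule field_le_epsilon)
  let ?M = "lebesgue_on {-L<..<L}"
  fix e :: real
  assume "0 < e"
  then have e: "0 < e / 2" by simp
  obtain p q where pq: "-L < p" "p < q" "q < L" "\<And>z. z \<in> {p..q} \<Longrightarrow> \<bar>v z - v x\<bar> \<le> e / 2"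
    by (rule step_near_point[OF xy(1) v e]) blast
  obtain p' q' where pq': "-L < p'" "p' < q'" "q' < L" "\<And>z. z \<in> {p'..q'} \<Longrightarrow> \<bar>v z - v y\<bar> \<le> e / 2"
    by (rule step_near_point[OF xy(2) v e]) blast
  obtain S where S: "smooth_step p q S"
    using smooth_step_exists[OF pq(2)] by blast
  obtain R where R: "smooth_step p' q' R"
    using smooth_step_exists[OF pq'(2)] by blast
  define \<phi> where "\<phi> z = S z - R z" for z
  have test: "test_function L \<phi>"
  proof (rule test_function_of_smooth)
    show "smooth_upto n \<phi>" for n
      unfolding \<phi>_def[abs_def] by (intro smooth_upto_diff step_smooth[OF S] step_smooth[OF R])
    let ?r = "max (max \<bar>p\<bar> \<bar>q\<bar>) (max \<bar>p'\<bar> \<bar>q'\<bar>)"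
    show "?r < L" using pq pq' by auto
    show "\<bar>z\<bar> \<le> ?r" if "\<phi> z \<noteq> 0" for z
    proof (rule ccontr)
      assume "\<not> \<bar>z\<bar> \<le> ?r"
      then have "\<bar>p\<bar> < \<bar>z\<bar>" "\<bar>q\<bar> < \<bar>z\<bar>" "\<bar>p'\<bar> < \<bar>z\<bar>" "\<bar>q'\<bar> < \<bar>z\<bar>"
        by (simp_all add: le_max_iff_disj not_le)
      \<comment> \<open>Outside both transition intervals the two steps agree, both being 0 on the
        left or both 1 on the right; this makes the support of their difference compact in (-L,
        L).\<close>
      then have "(z \<le> p \<and> z \<le> p') \<or> (q \<le> z \<and> q' \<le> z)" by linarith
      then show False using that step_left[OF S] step_left[OF R] step_right[OF S] step_right[OF R]
        by (auto simp: \<phi>_def)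
    qed
  qed
  have bd: "\<bar>\<phi> z\<bar> \<le> 1" for z
    using step_range[OF S, of z] step_range[OF R, of z] by (auto simp: \<phi>_def)
  have "deriv \<phi> z = deriv S z - deriv R z" for z
    unfolding \<phi>_def[abs_def]
    by (intro DERIV_imp_deriv DERIV_diff smooth_upto_DERIV[OF step_smooth[OF S]]
        smooth_upto_DERIV[OF step_smooth[OF R]])
  then have "(LINT z|?M. v z * deriv \<phi> z) = (LINT z|?M. v z * deriv S z) - (LINT z|?M. v z * deriv R z)"
    using integrable_lebesgue_on_open_continuous(1)[OF continuous_on_mult[OF v step_deriv_continuous[OF S]]]
      integrable_lebesgue_on_open_continuous(1)[OF continuous_on_mult[OF v step_deriv_continuous[OF R]]]
    by (simp add: right_diff_distrib)
  moreover have "\<bar>(LINT z|?M. v z * deriv S z) - v x\<bar> \<le> e / 2"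
    using step_deriv_average[OF S pq(1-3) v pq(4)] .
  moreover have "\<bar>(LINT z|?M. v z * deriv R z) - v y\<bar> \<le> e / 2"
    using step_deriv_average[OF R pq'(1-3) v pq'(4)] .
  moreover have "\<bar>LINT z|?M. v z * deriv \<phi> z\<bar> \<le> (LINT x|?M. \<bar>g x\<bar>)"
    using is_weak_deriv_bound[OF g(2,1) test bd] by simp
  ultimately show "\<bar>v x - v y\<bar> \<le> (LINT x|?M. \<bar>g x\<bar>) + e"
    by linarith
qed

text \<open>Every value of \<open>v\<close> differs from an average over the middle half of the
  interval by at most the L1 norm of the first weak derivative, and that average is bounded by the
  L1 norm of the weak derivative of order 0. One constant serves all orders
  \<open>s\<close>.\<close>

lemma H_norm_sup_bound:
  assumes "L > 0"
  obtains C where "0 \<le> C"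
    "\<And>s v x. 1 \<le> s \<Longrightarrow> v \<in> H_space L s \<Longrightarrow> x \<in> {-L..L} \<Longrightarrow> \<bar>v x\<bar> \<le> C * H_norm L s v"
proof -
  let ?M = "lebesgue_on {-L<..<L}"
  have pq: "-L < -L/2" "-L/2 < L/2" "L/2 < L"
    using assms by auto
  obtain S where S: "smooth_step (-L/2) (L/2) S"
    using smooth_step_exists[OF pq(2)] by blast
  have test: "test_function L (deriv S)"
    using step_deriv_test_function[OF S pq] .
  have "continuous_on {-L..L} (deriv S)"
    by (rule step_deriv_continuous[OF S])
  then have "bounded (deriv S ` {-L..L})"
    by (intro compact_imp_bounded compact_continuous_image) auto
  then obtain B where B: "\<And>z. z \<in> {-L..L} \<Longrightarrow> \<bar>deriv S z\<bar> \<le> B"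
    unfolding bounded_iff by fastforce
  have B0: "0 \<le> B" using B[of 0] assms by auto
  have B: "\<bar>deriv S z\<bar> \<le> B" for z
    using B[of z] step_deriv_eq_0[OF S, of z] B0 assms by (cases "z \<in> {-L..L}") auto
  show ?thesis
  proof (rule that[of "(1 + B) * (L + 1)"])
    show "0 \<le> (1 + B) * (L + 1)" using B0 assms by simp
    fix s v x
    assume s: "1 \<le> (s::nat)" and v: "v \<in> H_space L s" and x: "x \<in> {-L..L}"
    have cont: "continuous_on {-L..L} v" using s v by (auto simp: H_space_def)
    define N where "N j = (LINT x|?M. \<bar>weak_deriv L j v x\<bar>)" for j
    have bound: "\<bar>v y\<bar> \<le> N 1 + B * N 0" if y: "y \<in> {-L<..<L}" for y
    proof -
      have osc: "\<bar>v z - v y\<bar> \<le> N 1" if "z \<in> {-L/2..L/2}" for z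
        unfolding N_def using weak_deriv_spec[OF v s] that y assms
        by (intro weak_deriv_oscillation cont) auto
      have "\<bar>(LINT z|?M. v z * deriv S z) - v y\<bar> \<le> N 1"
        using step_deriv_average[OF S pq cont osc] .
      \<comment> \<open>\<open>H_norm\<close> contains the weak derivative of order 0 in place of
        \<open>v\<close>, so the average is also estimated through the weak identity, with
        \<open>deriv S\<close> as test function.\<close>
      moreover have "\<bar>LINT z|?M. v z * deriv S z\<bar> \<le> B * N 0"
        using is_weak_deriv_bound[OF weak_deriv_spec(2,1)[OF v] test B, of 0] by (simp add: N_def)
      ultimately show ?thesis by linarith
    qed
    have N: "N j \<le> (L + 1) * H_norm L s v" if "j \<le> s" for j
      unfolding N_def by (rule weak_deriv_L1_le_H_norm[OF v that assms])
    have "\<bar>v x\<bar> \<le> N 1 + B * N 0"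
    proof -
      \<comment> \<open>The bound was obtained at interior points; continuity of \<open>v\<close>
        carries it to the endpoints.\<close>
      have "closure {-L<..<L} = {-L..L}" using assms by simp
      then show ?thesis
        using continuous_on_closure_norm_le[of "{-L<..<L}" v "N 1 + B * N 0" x] cont bound x by auto
    qed
    also have "\<dots> \<le> (L + 1) * H_norm L s v + B * ((L + 1) * H_norm L s v)"
      using N[OF s] N[of 0] B0 by (intro add_mono mult_left_mono) auto
    finally show "\<bar>v x\<bar> \<le> (1 + B) * (L + 1) * H_norm L s v"
      by (simp add: algebra_simps)
  qed
qed

text \<open>By the embedding, continuity in time with respect to the Sobolev norm is uniform in
  \<open>x\<close>. Together with the continuity of a single time slice this gives joint continuity,
  each part taking half of the error.\<close>

lemma C_time_H_space_continuous:
  assumes "L > 0" "v \<in> C_time T X (H_norm L s)" "X \<subseteq> H_space L s" "1 \<le> s"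
  shows "continuous_on ({0..T} \<times> {-L..L}) (\<lambda>(t, x). v t x)"
proof -
  obtain C where C: "0 \<le> C"
    "\<And>s v x. 1 \<le> s \<Longrightarrow> v \<in> H_space L s \<Longrightarrow> x \<in> {-L..L} \<Longrightarrow> \<bar>v x\<bar> \<le> C * H_norm L s v"
    using H_norm_sup_bound[OF assms(1)] by metis
  have H: "v t \<in> H_space L s" if "t \<in> {0..T}" for t
    using assms that by (auto simp: C_time_def)
  show ?thesis
    unfolding continuous_on_iff
  proof (clarify)
    fix t x e :: real
    assume t: "t \<in> {0..T}" and x: "x \<in> {-L..L}" and e: "0 < e"
    \<comment> \<open>The denominator has C + 1 because C may be 0.\<close>
    define e' where "e' = e / (2 * (C + 1))"
    have e': "0 < e'" "C * e' < e / 2"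
      using e C(1) by (auto simp: e'_def field_simps)
    have "((\<lambda>\<tau>. H_norm L s (\<lambda>x. v \<tau> x - v t x)) \<longlongrightarrow> 0) (at t within {0..T})"
      using assms t by (auto simp: C_time_def)
    from tendstoD[OF this e'(1)] obtain \<delta> where \<delta>: "\<delta> > 0"
      "\<And>\<tau>. \<tau> \<in> {0..T} \<Longrightarrow> \<tau> \<noteq> t \<Longrightarrow> dist \<tau> t < \<delta> \<Longrightarrow> \<bar>H_norm L s (\<lambda>x. v \<tau> x - v t x)\<bar> < e'"
      by (auto simp: eventually_at)
    have "continuous_on {-L..L} (v t)"
      using H[OF t] assms(4) by (auto simp: H_space_def)
    then obtain \<gamma> where \<gamma>: "\<gamma> > 0"
      "\<And>y. y \<in> {-L..L} \<Longrightarrow> dist y x < \<gamma> \<Longrightarrow> dist (v t y) (v t x) < e / 2"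
      using x e unfolding continuous_on_iff by (metis half_gt_zero)
    show "\<exists>d>0. \<forall>p\<in>{0..T} \<times> {-L..L}. dist p (t, x) < d \<longrightarrow>
        dist (case p of (t, x) \<Rightarrow> v t x) (v t x) < e"
    proof (intro exI[of _ "min \<delta> \<gamma>"] conjI ballI impI)
      fix p
      assume p: "p \<in> {0..T} \<times> {-L..L}" "dist p (t, x) < min \<delta> \<gamma>"
      obtain \<tau> y where py: "p = (\<tau>, y)" by fastforce
      have d: "dist \<tau> t < \<delta>" "dist y x < \<gamma>"
        using p(2) dist_fst_le[of p "(t, x)"] dist_snd_le[of p "(t, x)"] by (auto simp: py)
      have \<tau>: "\<tau> \<in> {0..T}" and y: "y \<in> {-L..L}"
        using p(1) by (auto simp: py)
      have "\<bar>v \<tau> y - v t y\<bar> < e / 2"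
      proof (cases "\<tau> = t")
        case True
        then show ?thesis using e by simp
      next
        case False
        have "\<bar>v \<tau> y - v t y\<bar> \<le> C * H_norm L s (\<lambda>x. v \<tau> x - v t x)"
          using C(2)[OF assms(4) H_space_diff[OF H[OF \<tau>] H[OF t]] y] .
        also have "\<dots> \<le> C * e'"
          using \<delta>(2)[OF \<tau> False d(1)] C(1) by (intro mult_left_mono) auto
        finally show ?thesis using e'(2) by linarith
      qed
      moreover have "\<bar>v t y - v t x\<bar> < e / 2"
        using \<gamma>(2)[OF y d(2)] by (simp add: dist_real_def)
      ultimately show "dist (case p of (t, x) \<Rightarrow> v t x) (v t x) < e"
        unfolding py dist_real_def prod.case by linarith
    qed (use \<delta> \<gamma> in auto)
  qed
qed

section \<open>Functions continuously differentiable in space\<close>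

text \<open>The substitution \<xi> = c + s (x - c) moves the variable limit into the integrand of an
  integral over the fixed interval [0, 1], where continuity in parameters applies.\<close>

lemma continuous_on_upper_integral_param:
  fixes f :: "'p::topological_space \<Rightarrow> real \<Rightarrow> real"
  assumes "continuous_on (P \<times> {c..e}) (\<lambda>(p, s). f p s)"
  shows "continuous_on (P \<times> {c..e}) (\<lambda>(p, x). integral {c..x} (f p))"
proof -
  have eq: "integral {c..x} (f p) = (x - c) * integral {0..1} (\<lambda>s. f p (c + s * (x - c)))"
    if "p \<in> P" "x \<in> {c..e}" for p x
  proof (cases "x = c")
    case False
    then have x: "c < x" using that by auto
    have "continuous_on {c..x} (f p)"
      by (rule continuous_on_compose2[OF assms, of "{c..x}" "\<lambda>s. (p, s)", simplified])
        (use that in \<open>auto intro!: continuous_intros\<close>)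
    then have "(f p has_integral integral {c..x} (f p)) (cbox c x)"
      by (simp add: integrable_continuous_real integrable_integral)
    from has_integral_affinity[OF this, of "x - c" c] x
    have "((\<lambda>s. f p (c + s * (x - c))) has_integral (integral {c..x} (f p) / (x - c)))
        ((\<lambda>y. (1 / (x - c)) *\<^sub>R y + - ((1 / (x - c)) *\<^sub>R c)) ` {c..x})"
      by (simp add: algebra_simps divide_inverse)
    also have "(\<lambda>y. (1 / (x - c)) *\<^sub>R y + - ((1 / (x - c)) *\<^sub>R c)) ` {c..x} = {0..1}"
    proof -
      have "(\<lambda>y. (1 / (x - c)) *\<^sub>R y + - ((1 / (x - c)) *\<^sub>R c)) = (\<lambda>y. (y - c) / (x - c))"
        by (auto simp: diff_divide_distrib)
      moreover have "(\<lambda>y. (y - c) / (x - c)) ` {c..x} = {0..1}"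
      proof (intro equalityI subsetI)
        fix s :: real
        assume s: "s \<in> {0..1}"
        have "0 \<le> s * (x - c)" "s * (x - c) \<le> 1 * (x - c)"
          using x s by (auto intro!: mult_right_mono)
        then have "c + s * (x - c) \<in> {c..x}" by simp
        moreover have "s = (c + s * (x - c) - c) / (x - c)" using x by simp
        ultimately show "s \<in> (\<lambda>y. (y - c) / (x - c)) ` {c..x}" by blast
      qed (use x in auto)
      ultimately show ?thesis by (simp only:)
    qed
    finally have "integral {0..1} (\<lambda>s. f p (c + s * (x - c))) = integral {c..x} (f p) / (x - c)"
      by (rule integral_unique)
    then show ?thesis using x by simp
  qed simp
  have "continuous_on (P \<times> {c..e}) (\<lambda>q. integral (cbox 0 1) (\<lambda>s. f (fst q) (c + s * (snd q - c))))"
  proof (rule integral_continuous_on_param)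
    have in_range: "c + s * (x - c) \<in> {c..e}" if "x \<in> {c..e}" "0 \<le> s" "s \<le> 1" for x s
    proof -
      have "s * (x - c) \<le> 1 * (x - c)" "0 \<le> s * (x - c)"
        using that mult_right_mono[of s 1 "x - c"] by auto
      then show ?thesis using that by auto
    qed
    have "continuous_on ((P \<times> {c..e}) \<times> cbox 0 1)
        (\<lambda>z. (\<lambda>(p, s). f p s) (fst (fst z), c + snd z * (snd (fst z) - c)))"
      by (rule continuous_on_compose2[OF assms])
        (use in_range in \<open>auto intro!: continuous_intros simp: mem_Times_iff\<close>)
    then show "continuous_on ((P \<times> {c..e}) \<times> cbox 0 1)
        (\<lambda>(q, s). f (fst q) (c + s * (snd q - c)))"
      by (simp add: case_prod_unfold)
  qed
  then have "continuous_on (P \<times> {c..e})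
      (\<lambda>q. (snd q - c) * integral {0..1} (\<lambda>s. f (fst q) (c + s * (snd q - c))))"
    by (auto intro!: continuous_intros)
  then show ?thesis
    by (rule continuous_on_eq) (auto simp: eq)
qed

section \<open>Calculus of functions with a jointly continuous space derivative\<close>

definition jointly_continuous :: "real \<Rightarrow> real \<Rightarrow> (real \<Rightarrow> real \<Rightarrow> real) \<Rightarrow> bool" where
  "jointly_continuous T L A \<longleftrightarrow> continuous_on ({0..T} \<times> {-L..L}) (\<lambda>(t, x). A t x)"

text \<open>The derivative is a separate argument so that the rules below compute explicit formulas
  for it, which can then be differentiated again. Only values on the rectangle matter.\<close>

definition x_C1 ::
  "real \<Rightarrow> real \<Rightarrow> (real \<Rightarrow> real \<Rightarrow> real) \<Rightarrow> (real \<Rightarrow> real \<Rightarrow> real) \<Rightarrow> bool" where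
  "x_C1 T L A A' \<longleftrightarrow> jointly_continuous T L A \<and> jointly_continuous T L A' \<and>
     (\<forall>t\<in>{0..T}. \<forall>x\<in>{-L..L}. (A t has_real_derivative A' t x) (at x within {-L..L}))"

lemma jointly_continuous_x:
  assumes "jointly_continuous T L A" "t \<in> {0..T}"
  shows "continuous_on {-L..L} (A t)"
proof -
  have "continuous_on {-L..L} (\<lambda>x. (\<lambda>(t, x). A t x) (t, x))"
    by (rule continuous_on_compose2[OF assms(1)[unfolded jointly_continuous_def]])
      (use assms(2) in \<open>auto intro!: continuous_intros\<close>)
  then show ?thesis by simp
qed

lemma jointly_continuous_t:
  assumes "jointly_continuous T L A" "x \<in> {-L..L}" "S \<subseteq> {0..T}"
  shows "continuous_on S (\<lambda>t. A t x)"
proof -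
  have "continuous_on S (\<lambda>t. (\<lambda>(t, x). A t x) (t, x))"
    by (rule continuous_on_compose2[OF assms(1)[unfolded jointly_continuous_def]])
      (use assms(2,3) in \<open>auto intro!: continuous_intros\<close>)
  then show ?thesis by simp
qed

lemma jointly_continuous_cong:
  assumes "\<And>t x. t \<in> {0..T} \<Longrightarrow> x \<in> {-L..L} \<Longrightarrow> A t x = B t x"
  shows "jointly_continuous T L A \<longleftrightarrow> jointly_continuous T L B"
  unfolding jointly_continuous_def by (rule continuous_on_cong) (auto simp: assms)

lemma jointly_continuous_add:
  "jointly_continuous T L A \<Longrightarrow> jointly_continuous T L B \<Longrightarrow> jointly_continuous T L (\<lambda>t x. A t x + B t x)"
  by (simp add: jointly_continuous_def case_prod_unfold continuous_on_add)

lemma jointly_continuous_mult: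
  "jointly_continuous T L A \<Longrightarrow> jointly_continuous T L B \<Longrightarrow> jointly_continuous T L (\<lambda>t x. A t x * B t x)"
  by (simp add: jointly_continuous_def case_prod_unfold continuous_on_mult)

lemma jointly_continuous_of_t:
  assumes "continuous_on {0..T} f"
  shows "jointly_continuous T L (\<lambda>t x. f t)"
  unfolding jointly_continuous_def case_prod_unfold
  by (rule continuous_on_compose2[OF assms]) (auto intro!: continuous_intros)

lemma jointly_continuous_of_x:
  assumes "continuous_on {-L..L} f"
  shows "jointly_continuous T L (\<lambda>t x. f x)"
  unfolding jointly_continuous_def case_prod_unfold
  by (rule continuous_on_compose2[OF assms]) (auto intro!: continuous_intros)

lemma jointly_continuous_x_integral:
  assumes "jointly_continuous T L A"
  shows "jointly_continuous T L (\<lambda>t x. integral {-L..x} (A t))"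
  using continuous_on_upper_integral_param[OF assms[unfolded jointly_continuous_def]]
  by (simp add: jointly_continuous_def)

lemma jointly_continuous_t_integral:
  assumes "jointly_continuous T L A"
  shows "jointly_continuous T L (\<lambda>t x. integral {0..t} (\<lambda>\<tau>. A \<tau> x))"
proof -
  have "continuous_on ({-L..L} \<times> {0..T}) (\<lambda>q. (\<lambda>(t, x). A t x) (snd q, fst q))"
    by (rule continuous_on_compose2[OF assms[unfolded jointly_continuous_def]])
      (auto intro!: continuous_intros)
  then have "continuous_on ({-L..L} \<times> {0..T}) (\<lambda>(x, t). A t x)"
    by (simp add: case_prod_unfold)
  from continuous_on_upper_integral_param[OF this]
  have "continuous_on ({0..T} \<times> {-L..L})
      (\<lambda>q. (\<lambda>(x, t). integral {0..t} (\<lambda>\<tau>. A \<tau> x)) (snd q, fst q))"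
    by (rule continuous_on_compose2) (auto intro!: continuous_intros)
  then show ?thesis
    by (simp add: jointly_continuous_def case_prod_unfold)
qed

lemma x_C1_add:
  "x_C1 T L A A' \<Longrightarrow> x_C1 T L B B' \<Longrightarrow> x_C1 T L (\<lambda>t x. A t x + B t x) (\<lambda>t x. A' t x + B' t x)"
  by (auto simp: x_C1_def intro!: jointly_continuous_add DERIV_add)

lemma x_C1_mult:
  "x_C1 T L A A' \<Longrightarrow> x_C1 T L B B' \<Longrightarrow>
    x_C1 T L (\<lambda>t x. A t x * B t x) (\<lambda>t x. A' t x * B t x + B' t x * A t x)"
  by (auto simp: x_C1_def intro!: jointly_continuous_add jointly_continuous_mult DERIV_mult)

lemma x_C1_of_t:
  assumes "continuous_on {0..T} f"
  shows "x_C1 T L (\<lambda>t x. f t) (\<lambda>t x. 0)"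
  using assms by (auto simp: x_C1_def intro!: jointly_continuous_of_t)

lemma x_C1_mult_of_t:
  assumes "continuous_on {0..T} f" "x_C1 T L A A'"
  shows "x_C1 T L (\<lambda>t x. f t * A t x) (\<lambda>t x. f t * A' t x)"
  using x_C1_mult[OF x_C1_of_t[OF assms(1)] assms(2)] by (simp add: mult.commute)

lemma x_C1_cmult:
  "x_C1 T L A A' \<Longrightarrow> x_C1 T L (\<lambda>t x. c * A t x) (\<lambda>t x. c * A' t x)"
  by (rule x_C1_mult_of_t) auto

lemma x_C1_diff:
  assumes "x_C1 T L A A'" "x_C1 T L B B'"
  shows "x_C1 T L (\<lambda>t x. A t x - B t x) (\<lambda>t x. A' t x - B' t x)"
  using x_C1_add[OF assms(1) x_C1_cmult[OF assms(2), of "-1"]] by simp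

lemma x_C1_cong:
  assumes "x_C1 T L A A'" "\<And>t x. t \<in> {0..T} \<Longrightarrow> x \<in> {-L..L} \<Longrightarrow> A t x = B t x"
    "\<And>t x. t \<in> {0..T} \<Longrightarrow> x \<in> {-L..L} \<Longrightarrow> A' t x = B' t x"
  shows "x_C1 T L B B'"
proof -
  have "(B t has_real_derivative B' t x) (at x within {-L..L})" if "t \<in> {0..T}" "x \<in> {-L..L}" for t x
    by (rule has_field_derivative_transform_within[of "A t" _ _ _ 1])
      (use assms that in \<open>auto simp: x_C1_def\<close>)
  then show ?thesis
    using assms jointly_continuous_cong[of T L A B] jointly_continuous_cong[of T L A' B']
    by (auto simp: x_C1_def)
qed

text \<open>Differentiation under the integral sign; the joint continuity of the derivative is what
  the Leibniz rule asks for.\<close>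

lemma x_C1_t_integral:
  assumes "x_C1 T L A A'"
  shows "x_C1 T L (\<lambda>t x. integral {0..t} (\<lambda>\<tau>. A \<tau> x)) (\<lambda>t x. integral {0..t} (\<lambda>\<tau>. A' \<tau> x))"
proof -
  have "((\<lambda>x. integral (cbox 0 t) (\<lambda>\<tau>. A \<tau> x)) has_real_derivative
      integral (cbox 0 t) (\<lambda>\<tau>. A' \<tau> x)) (at x within {-L..L})"
    if "t \<in> {0..T}" "x \<in> {-L..L}" for t x
  proof (rule leibniz_rule_field_derivative[where fx="\<lambda>x \<tau>. A' \<tau> x"])
    show "((\<lambda>x. A s x) has_real_derivative A' s y) (at y within {-L..L})"
      if "y \<in> {-L..L}" "s \<in> cbox 0 t" for y s
      using assms that \<open>t \<in> {0..T}\<close> by (auto simp: x_C1_def)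
    show "(\<lambda>\<tau>. A \<tau> y) integrable_on cbox 0 t" if "y \<in> {-L..L}" for y
      unfolding cbox_interval
      by (intro integrable_continuous_real jointly_continuous_t[of T L])
        (use assms that \<open>t \<in> {0..T}\<close> in \<open>auto simp: x_C1_def\<close>)
    have "continuous_on ({-L..L} \<times> cbox 0 t) (\<lambda>q. (\<lambda>(t, x). A' t x) (snd q, fst q))"
      by (rule continuous_on_compose2[of "{0..T} \<times> {-L..L}"])
        (use assms \<open>t \<in> {0..T}\<close> in
          \<open>auto simp: x_C1_def jointly_continuous_def intro!: continuous_intros\<close>)
    then show "continuous_on ({-L..L} \<times> cbox 0 t) (\<lambda>(x, \<tau>). A' \<tau> x)"
      by (simp add: case_prod_unfold)
  qed (use that in auto)
  then show ?thesis
    using assms by (auto simp: x_C1_def intro!: jointly_continuous_t_integral)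
qed

lemma DERIV_t_integral:
  fixes w f :: "real \<Rightarrow> real"
  assumes "continuous_on {0..T} w" "\<And>t. t \<in> {0..T} \<Longrightarrow> f t = c + integral {0..t} w" "t \<in> {0..T}"
  shows "(f has_real_derivative w t) (at t within {0..T})"
proof -
  have "((\<lambda>t. c + integral {0..t} w) has_real_derivative w t) (at t within {0..T})"
    using DERIV_add[OF DERIV_const integral_has_real_derivative[OF assms(1,3)]] by simp
  then show ?thesis
    by (rule has_field_derivative_transform_within[of _ _ _ _ 1]) (use assms in auto)
qed

text \<open>The energy \<delta> A^2 + \<alpha> B^2 is conserved along A' = -\<alpha> B, B' =
  \<delta> A. It is zero at time 0, and both of its terms are nonnegative.\<close>

lemma rotating_system_zero:
  fixes A B :: "real \<Rightarrow> real"
  assumes "0 < \<alpha>" "0 < \<delta>" "continuous_on {0..T} A" "continuous_on {0..T} B"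
    and A: "\<And>t. t \<in> {0..T} \<Longrightarrow> A t = integral {0..t} (\<lambda>\<tau>. - \<alpha> * B \<tau>)"
    and B: "\<And>t. t \<in> {0..T} \<Longrightarrow> B t = integral {0..t} (\<lambda>\<tau>. \<delta> * A \<tau>)"
    and t: "t \<in> {0..T}"
  shows "A t = 0 \<and> B t = 0"
proof -
  have dA: "(A has_real_derivative - \<alpha> * B s) (at s within {0..T})" if "s \<in> {0..T}" for s
    by (rule DERIV_t_integral[where c=0]) (use assms that in \<open>auto intro!: continuous_intros\<close>)
  have dB: "(B has_real_derivative \<delta> * A s) (at s within {0..T})" if "s \<in> {0..T}" for s
    by (rule DERIV_t_integral[where c=0]) (use assms that in \<open>auto intro!: continuous_intros\<close>)
  have "((\<lambda>s. \<delta> * (A s)\<^sup>2 + \<alpha> * (B s)\<^sup>2) has_real_derivative 0) (at s within {0..T})"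
    if "s \<in> {0..T}" for s
    using dA[OF that] dB[OF that] by (auto intro!: derivative_eq_intros)
  then obtain c where c: "\<And>s. s \<in> {0..T} \<Longrightarrow> \<delta> * (A s)\<^sup>2 + \<alpha> * (B s)\<^sup>2 = c"
    using has_field_derivative_zero_constant[of "{0..T}"] by (metis (no_types, lifting) convex_real_interval(5))
  have "0 \<in> {0..T}" using t by auto
  then have "c = 0" using c[of 0] A[of 0] B[of 0] by simp
  then have "\<delta> * (A t)\<^sup>2 + \<alpha> * (B t)\<^sup>2 = 0" using c[OF t] by simp
  moreover have "0 \<le> \<delta> * (A t)\<^sup>2" "0 \<le> \<alpha> * (B t)\<^sup>2" using assms by auto
  ultimately have "\<delta> * (A t)\<^sup>2 = 0 \<and> \<alpha> * (B t)\<^sup>2 = 0" by linarith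
  then show ?thesis using assms by auto
qed

text \<open>Rotating \<open>(A, B)\<close> by the angle \<open>\<omega> t\<close> removes the coupling, so that the rotated
  components \<open>p\<close>, \<open>q\<close> are time integrals of the data alone and inherit its regularity in \<open>x\<close>.\<close>

lemma rotating_system_regularity:
  assumes pos: "0 < \<alpha>" "0 < \<delta>" "0 < L"
    and cont: "jointly_continuous T L A" "jointly_continuous T L B"
    and r: "x_C1 T L r r'" and s: "x_C1 T L s s'"
    and A0: "x_C1 T L (\<lambda>t. A0) (\<lambda>t. A0')" and B0: "x_C1 T L (\<lambda>t. B0) (\<lambda>t. B0')"
    and A: "\<And>t x. t \<in> {0..T} \<Longrightarrow> x \<in> {-L..L} \<Longrightarrow>
      A t x = A0 x + integral {0..t} (\<lambda>\<tau>. r \<tau> x - \<alpha> * B \<tau> x)"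
    and B: "\<And>t x. t \<in> {0..T} \<Longrightarrow> x \<in> {-L..L} \<Longrightarrow>
      B t x = B0 x + integral {0..t} (\<lambda>\<tau>. \<delta> * A \<tau> x + s \<tau> x)"
  obtains A' B' where "x_C1 T L A A'" "x_C1 T L B B'"
    "\<And>t x. t \<in> {0..T} \<Longrightarrow> x \<in> {-L..L} \<Longrightarrow>
      A' t x = A0' x + integral {0..t} (\<lambda>\<tau>. r' \<tau> x - \<alpha> * B' \<tau> x)"
    "\<And>t x. t \<in> {0..T} \<Longrightarrow> x \<in> {-L..L} \<Longrightarrow>
      B' t x = B0' x + integral {0..t} (\<lambda>\<tau>. \<delta> * A' \<tau> x + s' \<tau> x)"
proof -
  \<comment> \<open>\<omega> is the frequency of the homogeneous system. The factors \<kappa> and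
    \<mu> adjust the amplitudes of the two components, turning their elliptic orbits into a rotation
    that can be undone because \<kappa> \<mu> = 1.\<close>
  define \<omega> where "\<omega> = sqrt (\<alpha> * \<delta>)"
  have \<omega>: "0 < \<omega>" "\<alpha> * \<delta> = \<omega> * \<omega>"
    using pos by (auto simp: \<omega>_def)
  define \<kappa> \<mu> where "\<kappa> = \<alpha> / \<omega>" and "\<mu> = \<delta> / \<omega>"
  have \<kappa>: "\<kappa> * \<delta> = \<omega>" "\<kappa> * \<omega> = \<alpha>" "\<mu> * \<alpha> = \<omega>" "\<mu> * \<omega> = \<delta>" "\<kappa> * \<mu> = 1"
    using \<omega> by (auto simp: \<kappa>_def \<mu>_def field_simps)
  let ?c = "\<lambda>t. cos (\<omega> * t)" and ?s = "\<lambda>t. sin (\<omega> * t)"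
  have trig: "continuous_on S (\<lambda>t. m * ?c t)" "continuous_on S (\<lambda>t. m * ?s t)"
    "continuous_on S ?c" for S m
    by (auto intro!: continuous_intros)
  \<comment> \<open>\<phi> and \<psi> are the forcing terms rotated in the same way; they will turn
    out to be the time derivatives of the rotated components, free of \<open>A\<close> and
    \<open>B\<close>.\<close>
  define \<phi> where "\<phi> t x = ?c t * r t x + (\<kappa> * ?s t) * s t x" for t x
  define \<psi> where "\<psi> t x = ?c t * s t x - (\<mu> * ?s t) * r t x" for t x
  define p where "p t x = A0 x + integral {0..t} (\<lambda>\<tau>. \<phi> \<tau> x)" for t x
  define q where "q t x = B0 x + integral {0..t} (\<lambda>\<tau>. \<psi> \<tau> x)" for t x
  obtain \<phi>' where \<phi>': "x_C1 T L \<phi> \<phi>'"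
    using x_C1_add[OF x_C1_mult_of_t[OF trig(3) r] x_C1_mult_of_t[OF trig(2) s]]
    unfolding \<phi>_def[abs_def] by blast
  obtain \<psi>' where \<psi>': "x_C1 T L \<psi> \<psi>'"
    using x_C1_diff[OF x_C1_mult_of_t[OF trig(3) s] x_C1_mult_of_t[OF trig(2) r]]
    unfolding \<psi>_def[abs_def] by blast
  obtain p' where p': "x_C1 T L p p'"
    using x_C1_add[OF A0 x_C1_t_integral[OF \<phi>']] unfolding p_def[abs_def] by blast
  obtain q' where q': "x_C1 T L q q'"
    using x_C1_add[OF B0 x_C1_t_integral[OF \<psi>']] unfolding q_def[abs_def] by blast
  have rotated: "p t x = ?c t * A t x + \<kappa> * ?s t * B t x" (is "_ = ?P t")
    "q t x = ?c t * B t x - \<mu> * ?s t * A t x" (is "_ = ?Q t")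
    if t: "t \<in> {0..T}" and x: "x \<in> {-L..L}" for t x
  proof -
    have ct: "continuous_on {0..T} (\<lambda>t. A t x)" "continuous_on {0..T} (\<lambda>t. B t x)"
      "continuous_on {0..T} (\<lambda>t. r t x)" "continuous_on {0..T} (\<lambda>t. s t x)"
      using cont r s x by (auto simp: x_C1_def intro!: jointly_continuous_t)
    have dA: "((\<lambda>t. A t x) has_real_derivative r y x - \<alpha> * B y x) (at y within {0..T})"
      if "y \<in> {0..T}" for y
      by (rule DERIV_t_integral[OF _ _ that]) (auto intro!: continuous_intros ct A x)
    have dB: "((\<lambda>t. B t x) has_real_derivative \<delta> * A y x + s y x) (at y within {0..T})"
      if "y \<in> {0..T}" for y
      by (rule DERIV_t_integral[OF _ _ that]) (auto intro!: continuous_intros ct B x)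
    have dP: "((\<lambda>t. ?c t * A t x + \<kappa> * ?s t * B t x) has_real_derivative \<phi> y x) (at y within {0..T})"
      if "y \<in> {0..T}" for y
    proof -
      \<comment> \<open>The product rule leaves these coefficients of \<open>A\<close> and
        \<open>B\<close>; both vanish by the choice of \<kappa>.\<close>
      have "((\<lambda>t. ?c t * A t x + \<kappa> * ?s t * B t x) has_real_derivative
          \<phi> y x + (\<kappa> * \<delta> - \<omega>) * ?s y * A y x + (\<kappa> * \<omega> - \<alpha>) * ?c y * B y x) (at y within {0..T})"
        using dA[OF that] dB[OF that]
        by (auto intro!: derivative_eq_intros simp: \<phi>_def algebra_simps)
      then show ?thesis by (simp add: \<kappa>)
    qed
    have "((\<lambda>\<tau>. \<phi> \<tau> x) has_integral (?P t - ?P 0)) {0..t}"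
      using t by (intro fundamental_theorem_of_calculus)
        (auto simp flip: has_real_derivative_iff_has_vector_derivative intro!: DERIV_subset[OF dP])
    moreover have "A 0 x = A0 x" "B 0 x = B0 x" using A[of 0 x] B[of 0 x] t x by auto
    ultimately show "p t x = ?P t" by (simp add: p_def integral_unique)
    have dQ: "((\<lambda>t. ?c t * B t x - \<mu> * ?s t * A t x) has_real_derivative \<psi> y x) (at y within {0..T})"
      if "y \<in> {0..T}" for y
    proof -
      have "((\<lambda>t. ?c t * B t x - \<mu> * ?s t * A t x) has_real_derivative
          \<psi> y x + (\<mu> * \<alpha> - \<omega>) * ?s y * B y x + (\<delta> - \<mu> * \<omega>) * ?c y * A y x) (at y within {0..T})"
        using dA[OF that] dB[OF that]
        by (auto intro!: derivative_eq_intros simp: \<psi>_def algebra_simps)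
      then show ?thesis by (simp add: \<kappa>)
    qed
    have "((\<lambda>\<tau>. \<psi> \<tau> x) has_integral (?Q t - ?Q 0)) {0..t}"
      using t by (intro fundamental_theorem_of_calculus)
        (auto simp flip: has_real_derivative_iff_has_vector_derivative intro!: DERIV_subset[OF dQ])
    then show "q t x = ?Q t"
      using \<open>B 0 x = B0 x\<close> by (simp add: q_def integral_unique)
  qed
  have unrotated: "?c t * p t x - \<kappa> * ?s t * q t x = A t x" "?c t * q t x + \<mu> * ?s t * p t x = B t x"
    if "t \<in> {0..T}" "x \<in> {-L..L}" for t x
  proof -
    \<comment> \<open>Inverting the rotation: the mixed terms cancel, and \<kappa> \<mu> = 1 reduces
      the bracket to cos^2 + sin^2.\<close>
    have "?c t * p t x - \<kappa> * ?s t * q t x = ((?c t)\<^sup>2 + (\<kappa> * \<mu>) * (?s t)\<^sup>2) * A t x"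
      "?c t * q t x + \<mu> * ?s t * p t x = ((?c t)\<^sup>2 + (\<kappa> * \<mu>) * (?s t)\<^sup>2) * B t x"
      unfolding rotated[OF that] by (simp_all add: algebra_simps power2_eq_square)
    then show "?c t * p t x - \<kappa> * ?s t * q t x = A t x" "?c t * q t x + \<mu> * ?s t * p t x = B t x"
      unfolding \<kappa>(5) by simp_all
  qed
  have "x_C1 T L A (\<lambda>t x. ?c t * p' t x - \<kappa> * ?s t * q' t x)"
    by (rule x_C1_cong[OF x_C1_diff[OF x_C1_mult_of_t[OF trig(3) p'] x_C1_mult_of_t[OF trig(2)[where m=\<kappa>] q']]])
      (simp_all add: unrotated)
  then obtain A' where A': "x_C1 T L A A'" by blast
  have "x_C1 T L B (\<lambda>t x. ?c t * q' t x + \<mu> * ?s t * p' t x)"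
    by (rule x_C1_cong[OF x_C1_add[OF x_C1_mult_of_t[OF trig(3) q'] x_C1_mult_of_t[OF trig(2)[where m=\<mu>] p']]])
      (simp_all add: unrotated)
  then obtain B' where B': "x_C1 T L B B'" by blast
  \<comment> \<open>The rotated formulas establish that \<open>A'\<close> and \<open>B'\<close>
    exist. Their integral equations come from differentiating the original equations under the
    integral, and uniqueness of the derivative identifies the two results.\<close>
  have unique: "D t x = E t x"
    if "x_C1 T L F D" "x_C1 T L F E" "t \<in> {0..T}" "x \<in> {-L..L}" for F D E t x
  proof -
    have "(F t has_vector_derivative D t x) (at x within cbox (-L) L)"
      "(F t has_vector_derivative E t x) (at x within cbox (-L) L)"
      using that by (auto simp: x_C1_def has_real_derivative_iff_has_vector_derivative)
    then show ?thesis
      using vector_derivative_unique_within_closed_interval[of "-L" L x "F t"] pos that(4) by auto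
  qed
  show ?thesis
  proof (rule that[OF A' B'])
    fix t x
    assume tx: "t \<in> {0..T}" "x \<in> {-L..L}"
    have "x_C1 T L A (\<lambda>t x. A0' x + integral {0..t} (\<lambda>\<tau>. r' \<tau> x - \<alpha> * B' \<tau> x))"
      by (rule x_C1_cong[OF x_C1_add[OF A0 x_C1_t_integral[OF x_C1_diff[OF r x_C1_cmult[OF B']]]]])
        (simp_all add: A)
    then show "A' t x = A0' x + integral {0..t} (\<lambda>\<tau>. r' \<tau> x - \<alpha> * B' \<tau> x)"
      using unique[OF A' _ tx] by blast
    have "x_C1 T L B (\<lambda>t x. B0' x + integral {0..t} (\<lambda>\<tau>. \<delta> * A' \<tau> x + s' \<tau> x))"
      by (rule x_C1_cong[OF x_C1_add[OF B0 x_C1_t_integral[OF x_C1_add[OF x_C1_cmult[OF A'] s]]]])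
        (simp_all add: B)
    then show "B' t x = B0' x + integral {0..t} (\<lambda>\<tau>. \<delta> * A' \<tau> x + s' \<tau> x)"
      using unique[OF B' _ tx] by blast
  qed
qed

section \<open>Green's operators\<close>

lemma x_C1_of_x:
  assumes "\<And>x. (f has_real_derivative f' x) (at x)" "continuous_on {-L..L} f'"
  shows "x_C1 T L (\<lambda>t. f) (\<lambda>t. f')"
proof -
  have "continuous_on {-L..L} f"
    using assms(1) DERIV_isCont continuous_at_imp_continuous_on by blast
  then show ?thesis
    using assms by (auto simp: x_C1_def intro!: jointly_continuous_of_x DERIV_subset[OF assms(1)])
qed

lemma x_C1_x_integral:
  assumes "jointly_continuous T L w"
  shows "x_C1 T L (\<lambda>t x. integral {-L..x} (w t)) w"
  using assms jointly_continuous_x[OF assms]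
  by (auto simp: x_C1_def intro!: jointly_continuous_x_integral integral_has_real_derivative)

lemma x_C1_x_integral_lower:
  assumes w: "jointly_continuous T L w" and "0 < L"
  shows "x_C1 T L (\<lambda>t x. integral {x..L} (w t)) (\<lambda>t x. - w t x)"
proof -
  have "continuous_on {0..T} (\<lambda>t. integral {-L..L} (w t))"
    using jointly_continuous_t[OF jointly_continuous_x_integral[OF w], of L "{0..T}"] assms(2) by simp
  from x_C1_diff[OF x_C1_of_t[OF this] x_C1_x_integral[OF w]] show ?thesis
  proof (rule x_C1_cong)
    fix t x assume "t \<in> {0..T}" "x \<in> {-L..L}"
    then show "integral {-L..L} (w t) - integral {-L..x} (w t) = integral {x..L} (w t)"
      using Henstock_Kurzweil_Integration.integral_combine[of "-L" x L "w t"]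
        integrable_continuous_real[OF jointly_continuous_x[OF w]]
      by (auto simp: algebra_simps)
  qed simp
qed

definition green_left :: "(real \<Rightarrow> real) \<Rightarrow> real \<Rightarrow> real \<Rightarrow> (real \<Rightarrow> real) \<Rightarrow> real \<Rightarrow> real" where
  "green_left g c L f x = integral {-L..x} (\<lambda>\<xi>. g ((L + \<xi>) / sqrt c) * f \<xi>)"

definition green_right :: "(real \<Rightarrow> real) \<Rightarrow> real \<Rightarrow> real \<Rightarrow> (real \<Rightarrow> real) \<Rightarrow> real \<Rightarrow> real" where
  "green_right g c L f x = integral {x..L} (\<lambda>\<xi>. g ((L - \<xi>) / sqrt c) * f \<xi>)"

text \<open>The closed form of the Green's operator: the kernel derivative is inserted on each side
  of the diagonal and the factors depending on \<open>x\<close> are taken out of the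
  integrals.\<close>

definition green_value ::
  "(real \<Rightarrow> real) \<Rightarrow> (real \<Rightarrow> real) \<Rightarrow> real \<Rightarrow> real \<Rightarrow> (real \<Rightarrow> real) \<Rightarrow> real \<Rightarrow> real" where
  "green_value h g c L f x = 1 / (c * sinh (2 * L / sqrt c)) *
     (h ((L - x) / sqrt c) * green_left g c L f x - h ((L + x) / sqrt c) * green_right g c L f x)"

text \<open>The part of the x-derivative of \<open>green_value\<close> in which the weights are
  differentiated. The remaining part comes from the integration limits.\<close>

definition green_slope ::
  "(real \<Rightarrow> real) \<Rightarrow> real \<Rightarrow> real \<Rightarrow> (real \<Rightarrow> real) \<Rightarrow> real \<Rightarrow> real" where
  "green_slope g c L f x = - 1 / (c * sqrt c * sinh (2 * L / sqrt c)) *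
     (g ((L - x) / sqrt c) * green_left g c L f x + g ((L + x) / sqrt c) * green_right g c L f x)"

text \<open>The pair \<open>h, g\<close> stands for \<open>cosh, sinh\<close> or \<open>sinh, cosh\<close>.\<close>

context
  fixes h g :: "real \<Rightarrow> real" and c L :: real
  assumes h: "\<And>x. (h has_real_derivative g x) (at x)"
    and g: "\<And>x. (g has_real_derivative h x) (at x)"
    and add: "\<And>x y. h x * g y + g x * h y = sinh (x + y)"
    and c: "0 < c" and L: "0 < L"
begin

lemma green_sinh_pos: "0 < sinh (2 * L / sqrt c)"
  using c L by simp

lemma green_weights_continuous:
  "continuous_on S (\<lambda>x. h ((L - x) / sqrt c))" "continuous_on S (\<lambda>x. h ((L + x) / sqrt c))"
  "continuous_on S (\<lambda>x. g ((L - x) / sqrt c))" "continuous_on S (\<lambda>x. g ((L + x) / sqrt c))"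
proof -
  have "continuous_on UNIV h" "continuous_on UNIV g"
    using h g DERIV_isCont continuous_at_imp_continuous_on by blast+
  then show "continuous_on S (\<lambda>x. h ((L - x) / sqrt c))" "continuous_on S (\<lambda>x. h ((L + x) / sqrt c))"
    "continuous_on S (\<lambda>x. g ((L - x) / sqrt c))" "continuous_on S (\<lambda>x. g ((L + x) / sqrt c))"
    using c by (auto intro!: continuous_on_compose2[of UNIV h] continuous_on_compose2[of UNIV g]
        continuous_intros)
qed

lemma green_weights_x_C1:
  "x_C1 T L (\<lambda>t x. h ((L - x) / sqrt c)) (\<lambda>t x. - 1 / sqrt c * g ((L - x) / sqrt c))"
  "x_C1 T L (\<lambda>t x. h ((L + x) / sqrt c)) (\<lambda>t x. 1 / sqrt c * g ((L + x) / sqrt c))"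
  "x_C1 T L (\<lambda>t x. g ((L - x) / sqrt c)) (\<lambda>t x. - 1 / sqrt c * h ((L - x) / sqrt c))"
  "x_C1 T L (\<lambda>t x. g ((L + x) / sqrt c)) (\<lambda>t x. 1 / sqrt c * h ((L + x) / sqrt c))"
proof -
  have m: "((\<lambda>x. (L - x) / sqrt c) has_real_derivative - 1 / sqrt c) (at x)" for x
    by (rule DERIV_cdivide) (auto intro!: derivative_eq_intros)
  have p: "((\<lambda>x. (L + x) / sqrt c) has_real_derivative 1 / sqrt c) (at x)" for x
    by (rule DERIV_cdivide) (auto intro!: derivative_eq_intros)
  show "x_C1 T L (\<lambda>t x. h ((L - x) / sqrt c)) (\<lambda>t x. - 1 / sqrt c * g ((L - x) / sqrt c))"
    "x_C1 T L (\<lambda>t x. h ((L + x) / sqrt c)) (\<lambda>t x. 1 / sqrt c * g ((L + x) / sqrt c))"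
    "x_C1 T L (\<lambda>t x. g ((L - x) / sqrt c)) (\<lambda>t x. - 1 / sqrt c * h ((L - x) / sqrt c))"
    "x_C1 T L (\<lambda>t x. g ((L + x) / sqrt c)) (\<lambda>t x. 1 / sqrt c * h ((L + x) / sqrt c))"
    using DERIV_chain2[OF h m] DERIV_chain2[OF h p] DERIV_chain2[OF g m] DERIV_chain2[OF g p]
    by (intro x_C1_of_x continuous_on_mult continuous_on_const green_weights_continuous;
        simp add: mult.commute)+
qed

lemma green_left_x_C1:
  assumes "jointly_continuous T L f"
  shows "x_C1 T L (\<lambda>t. green_left g c L (f t)) (\<lambda>t x. g ((L + x) / sqrt c) * f t x)"
  unfolding green_left_def
  by (intro x_C1_x_integral jointly_continuous_mult jointly_continuous_of_x assms
      green_weights_continuous)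

lemma green_right_x_C1:
  assumes "jointly_continuous T L f"
  shows "x_C1 T L (\<lambda>t. green_right g c L (f t)) (\<lambda>t x. - (g ((L - x) / sqrt c) * f t x))"
  unfolding green_right_def
  by (intro x_C1_x_integral_lower jointly_continuous_mult jointly_continuous_of_x assms
      green_weights_continuous L)

text \<open>Differentiating the limits produces \<open>f\<close> times the Wronskian of the weights,
  which is the constant sinh (2L / sqrt c) by the addition formula. It cancels the normalization and
  leaves the jump term f / c.\<close>

lemma green_value_x_C1:
  assumes f: "jointly_continuous T L f"
  shows "x_C1 T L (\<lambda>t. green_value h g c L (f t)) (\<lambda>t x. f t x / c + green_slope g c L (f t) x)"
proof -
  define \<sigma> where "\<sigma> = sinh (2 * L / sqrt c)"
  have \<sigma>: "0 < \<sigma>" unfolding \<sigma>_def by (rule green_sinh_pos)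
  have wronskian: "h ((L - x) / sqrt c) * g ((L + x) / sqrt c) +
      g ((L - x) / sqrt c) * h ((L + x) / sqrt c) = \<sigma>" for x
    unfolding add \<sigma>_def by (simp flip: add_divide_distrib)
  show ?thesis
  proof (rule x_C1_cong[OF x_C1_cmult[OF x_C1_diff[OF
            x_C1_mult[OF green_weights_x_C1(1) green_left_x_C1[OF f]]
            x_C1_mult[OF green_weights_x_C1(2) green_right_x_C1[OF f]]],
          of "1 / (c * sinh (2 * L / sqrt c))"]])
    fix t x
    show "1 / (c * sinh (2 * L / sqrt c)) *
        (h ((L - x) / sqrt c) * green_left g c L (f t) x -
         h ((L + x) / sqrt c) * green_right g c L (f t) x) = green_value h g c L (f t) x"
      by (simp add: green_value_def)
    define P Q where "P = green_left g c L (f t) x" and "Q = green_right g c L (f t) x"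
    have "1 / (c * \<sigma>) *
        (- 1 / sqrt c * g ((L - x) / sqrt c) * P + g ((L + x) / sqrt c) * f t x * h ((L - x) / sqrt c) -
         (1 / sqrt c * g ((L + x) / sqrt c) * Q + - (g ((L - x) / sqrt c) * f t x) * h ((L + x) / sqrt c)))
      = 1 / (c * \<sigma>) * (f t x * (h ((L - x) / sqrt c) * g ((L + x) / sqrt c) +
      g ((L - x) / sqrt c) * h ((L + x) / sqrt c)) -
         1 / sqrt c * (g ((L - x) / sqrt c) * P + g ((L + x) / sqrt c) * Q))"
      by (simp add: algebra_simps)
    also have "\<dots> = f t x / c + - 1 / (c * sqrt c * \<sigma>) *
        (g ((L - x) / sqrt c) * P + g ((L + x) / sqrt c) * Q)"
      unfolding wronskian using c \<sigma> by (simp add: right_diff_distrib)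
    finally show "1 / (c * sinh (2 * L / sqrt c)) *
        (- 1 / sqrt c * g ((L - x) / sqrt c) * green_left g c L (f t) x +
         g ((L + x) / sqrt c) * f t x * h ((L - x) / sqrt c) -
         (1 / sqrt c * g ((L + x) / sqrt c) * green_right g c L (f t) x +
          - (g ((L - x) / sqrt c) * f t x) * h ((L + x) / sqrt c)))
      = f t x / c + green_slope g c L (f t) x"
      by (simp add: green_slope_def P_def Q_def \<sigma>_def)
  qed
qed

text \<open>Here the two contributions of the limits cancel, and differentiating \<open>g\<close>
  brings back \<open>h\<close>. So the slope is smoother than the value; together with the previous
  lemma, w = \<open>green_value\<close> satisfies w - c w'' = -f' whenever f is
  differentiable.\<close>

lemma green_slope_x_C1:
  assumes f: "jointly_continuous T L f"
  shows "x_C1 T L (\<lambda>t. green_slope g c L (f t)) (\<lambda>t x. green_value h g c L (f t) x / c)"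
proof -
  define \<sigma> where "\<sigma> = sinh (2 * L / sqrt c)"
  have \<sigma>: "0 < \<sigma>" unfolding \<sigma>_def by (rule green_sinh_pos)
  show ?thesis
  proof (rule x_C1_cong[OF x_C1_cmult[OF x_C1_add[OF
            x_C1_mult[OF green_weights_x_C1(3) green_left_x_C1[OF f]]
            x_C1_mult[OF green_weights_x_C1(4) green_right_x_C1[OF f]]],
          of "- 1 / (c * sqrt c * sinh (2 * L / sqrt c))"]])
    fix t x
    show "- 1 / (c * sqrt c * sinh (2 * L / sqrt c)) *
        (g ((L - x) / sqrt c) * green_left g c L (f t) x +
         g ((L + x) / sqrt c) * green_right g c L (f t) x) = green_slope g c L (f t) x"
      by (simp add: green_slope_def)
    define P Q where "P = green_left g c L (f t) x" and "Q = green_right g c L (f t) x"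
    have "- 1 / (c * sqrt c * \<sigma>) *
        (- 1 / sqrt c * h ((L - x) / sqrt c) * P + g ((L + x) / sqrt c) * f t x * g ((L - x) / sqrt c) +
         (1 / sqrt c * h ((L + x) / sqrt c) * Q + - (g ((L - x) / sqrt c) * f t x) * g ((L + x) / sqrt c)))
      = 1 / (c * (sqrt c * sqrt c) * \<sigma>) * (h ((L - x) / sqrt c) * P - h ((L + x) / sqrt c) * Q)"
      using c \<sigma> by (simp add: field_simps del: real_sqrt_mult_self)
    also have "\<dots> = 1 / (c * \<sigma>) * (h ((L - x) / sqrt c) * P - h ((L + x) / sqrt c) * Q) / c"
      using c by simp
    finally show "- 1 / (c * sqrt c * sinh (2 * L / sqrt c)) *
        (- 1 / sqrt c * h ((L - x) / sqrt c) * green_left g c L (f t) x +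
         g ((L + x) / sqrt c) * f t x * g ((L - x) / sqrt c) +
         (1 / sqrt c * h ((L + x) / sqrt c) * green_right g c L (f t) x +
          - (g ((L - x) / sqrt c) * f t x) * g ((L + x) / sqrt c)))
      = green_value h g c L (f t) x / c"
      by (simp add: green_value_def P_def Q_def \<sigma>_def)
  qed
qed

lemma deriv_green_kernel:
  shows "\<xi> < x \<Longrightarrow> deriv (green_kernel h c L x) \<xi> =
      1 / (c * sinh (2 * L / sqrt c)) * h ((L - x) / sqrt c) * g ((L + \<xi>) / sqrt c)"
    and "x < \<xi> \<Longrightarrow> deriv (green_kernel h c L x) \<xi> =
      - 1 / (c * sinh (2 * L / sqrt c)) * h ((L + x) / sqrt c) * g ((L - \<xi>) / sqrt c)"
proof -
  define \<sigma> where "\<sigma> = sinh (2 * L / sqrt c)"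
  have \<sigma>: "0 < \<sigma>" unfolding \<sigma>_def by (rule green_sinh_pos)
  \<comment> \<open>-1 / (c W) equals sqrt c / (c \<sigma>), and this sqrt c later cancels the chain
    rule factor 1 / sqrt c.\<close>
  have K: "green_kernel h c L x = (\<lambda>\<xi>. sqrt c / (c * \<sigma>) *
      (if \<xi> \<le> x then h ((L + \<xi>) / sqrt c) * h ((L - x) / sqrt c)
       else h ((L + x) / sqrt c) * h ((L - \<xi>) / sqrt c)))"
    by (simp add: green_kernel_def[abs_def] Let_def \<sigma>_def mult.commute)
  have m: "((\<lambda>x. (L - x) / sqrt c) has_real_derivative - 1 / sqrt c) (at y)" for y
    by (rule DERIV_cdivide) (auto intro!: derivative_eq_intros)
  have p: "((\<lambda>x. (L + x) / sqrt c) has_real_derivative 1 / sqrt c) (at y)" for y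
    by (rule DERIV_cdivide) (auto intro!: derivative_eq_intros)
  {
    assume "\<xi> < x"
    have "((\<lambda>\<xi>. sqrt c / (c * \<sigma>) * (h ((L + \<xi>) / sqrt c) * h ((L - x) / sqrt c))) has_real_derivative
        1 / (c * \<sigma>) * h ((L - x) / sqrt c) * g ((L + \<xi>) / sqrt c)) (at \<xi>)"
      using c \<sigma> DERIV_chain2[OF h p] by (auto intro!: derivative_eq_intros simp: field_simps)
    then have "(green_kernel h c L x has_real_derivative
        1 / (c * \<sigma>) * h ((L - x) / sqrt c) * g ((L + \<xi>) / sqrt c)) (at \<xi>)"
      by (rule has_field_derivative_transform_within_open[where S="{..<x}"])
        (use \<open>\<xi> < x\<close> in \<open>auto simp: K\<close>)
    then show "deriv (green_kernel h c L x) \<xi> =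
        1 / (c * sinh (2 * L / sqrt c)) * h ((L - x) / sqrt c) * g ((L + \<xi>) / sqrt c)"
      unfolding \<sigma>_def by (rule DERIV_imp_deriv)
  next
    assume "x < \<xi>"
    have "((\<lambda>\<xi>. sqrt c / (c * \<sigma>) * (h ((L + x) / sqrt c) * h ((L - \<xi>) / sqrt c))) has_real_derivative
        - 1 / (c * \<sigma>) * h ((L + x) / sqrt c) * g ((L - \<xi>) / sqrt c)) (at \<xi>)"
      using c \<sigma> DERIV_chain2[OF h m] by (auto intro!: derivative_eq_intros simp: field_simps)
    then have "(green_kernel h c L x has_real_derivative
        - 1 / (c * \<sigma>) * h ((L + x) / sqrt c) * g ((L - \<xi>) / sqrt c)) (at \<xi>)"
      by (rule has_field_derivative_transform_within_open[where S="{x<..}"])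
        (use \<open>x < \<xi>\<close> in \<open>auto simp: K\<close>)
    then show "deriv (green_kernel h c L x) \<xi> =
        - 1 / (c * sinh (2 * L / sqrt c)) * h ((L + x) / sqrt c) * g ((L - \<xi>) / sqrt c)"
      unfolding \<sigma>_def by (rule DERIV_imp_deriv)
  }
qed

text \<open>Split at \<xi> = x, the integrand agrees on each side with a continuous branch except at
  the diagonal point, a null set.\<close>

lemma green_operator_eq_green_value:
  assumes f: "continuous_on {-L..L} f" and x: "x \<in> {-L..L}"
  shows "green_operator (green_kernel h c L) L f x = green_value h g c L f x"
proof -
  let ?k = "\<lambda>\<xi>. deriv (green_kernel h c L x) \<xi> * f \<xi>"
  let ?a = "1 / (c * sinh (2 * L / sqrt c)) * h ((L - x) / sqrt c)"
  let ?b = "- 1 / (c * sinh (2 * L / sqrt c)) * h ((L + x) / sqrt c)"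
  let ?l = "\<lambda>\<xi>. ?a * (g ((L + \<xi>) / sqrt c) * f \<xi>)"
  let ?r = "\<lambda>\<xi>. ?b * (g ((L - \<xi>) / sqrt c) * f \<xi>)"
  have cont: "continuous_on {-L..x} ?l" "continuous_on {x..L} ?r"
    by (intro continuous_on_mult continuous_on_const green_weights_continuous
        continuous_on_subset[OF f]; use x in auto)+
  have eq: "?k \<xi> = ?l \<xi>" if "\<xi> \<in> {-L..x} - {x}" for \<xi>
    using that deriv_green_kernel(1)[of \<xi> x] by simp
  have eq': "?k \<xi> = ?r \<xi>" if "\<xi> \<in> {x..L} - {x}" for \<xi>
    using that deriv_green_kernel(2)[of x \<xi>] by simp
  have "?k absolutely_integrable_on {-L..x}"
    by (rule absolutely_integrable_spike[OF absolutely_integrable_continuous_real[OF cont(1)],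
          of "{x}"]) (use eq in auto)
  moreover have "?k absolutely_integrable_on {x..L}"
    by (rule absolutely_integrable_spike[OF absolutely_integrable_continuous_real[OF cont(2)],
          of "{x}"]) (use eq' in auto)
  ultimately have "?k absolutely_integrable_on ({-L..x} \<union> {x..L})"
    by (rule absolutely_integrable_Un)
  moreover have un: "{-L..x} \<union> {x..L} = {-L..L}"
    using x by auto
  ultimately have int: "?k absolutely_integrable_on {-L..L}" by simp
  then have "integrable (lebesgue_on {-L..L}) ?k"
    by (simp add: integrable_restrict_space set_integrable_def)
  then have "green_operator (green_kernel h c L) L f x = integral {-L..L} ?k"
    unfolding green_operator_def by (rule lebesgue_integral_eq_integral) simp
  also have "\<dots> = integral {-L..x} ?k + integral {x..L} ?k"
    using x set_lebesgue_integral_eq_integral(1)[OF int]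
    by (intro Henstock_Kurzweil_Integration.integral_combine[symmetric]) auto
  also have "integral {-L..x} ?k = integral {-L..x} ?l"
    by (rule integral_spike[of "{x}"]) (use eq in auto)
  also have "integral {x..L} ?k = integral {x..L} ?r"
    by (rule integral_spike[of "{x}"]) (use eq' in auto)
  also have "integral {-L..x} ?l + integral {x..L} ?r =
      ?a * green_left g c L f x + ?b * green_right g c L f x"
    by (simp only: green_left_def green_right_def integral_mult_right)
  also have "\<dots> = green_value h g c L f x"
    by (simp add: green_value_def algebra_simps)
  finally show ?thesis .
qed

text \<open>At each endpoint one integral is over a degenerate interval and the other has the weight
  \<open>h 0\<close>. The slope behaves likewise with \<open>g 0\<close>.\<close>

lemma green_value_boundary:
  assumes "h 0 = 0"
  shows "green_value h g c L f (-L) = 0" "green_value h g c L f L = 0"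
  by (simp_all add: green_value_def green_left_def green_right_def assms)

lemma green_slope_boundary:
  assumes "g 0 = 0"
  shows "green_slope g c L f (-L) = 0" "green_slope g c L f L = 0"
  by (simp_all add: green_slope_def green_left_def green_right_def assms)

end

section \<open>Spaces of differentiable functions\<close>

lemma vector_derivative_within_interval:
  assumes "(f has_real_derivative D) (at x within {l..r})" "l < r" "x \<in> {l..r}"
  shows "vector_derivative f (at x within {l..r}) = D"
  using assms vector_derivative_within_cbox[of l r x f D]
  by (simp add: has_real_derivative_iff_has_vector_derivative)

lemma Dx_eq:
  assumes "(f has_real_derivative D) (at x within {-L..L})" "0 < L" "x \<in> {-L..L}"
  shows "Dx L f x = D"
  unfolding Dx_def using assms by (intro vector_derivative_within_interval) auto

lemma funpow_Dx_eq:
  assumes "0 < L" "j \<le> s"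
    and F: "\<And>j x. j < s \<Longrightarrow> x \<in> {-L..L} \<Longrightarrow> (F j has_real_derivative F (Suc j) x) (at x within {-L..L})"
    and f: "\<And>x. x \<in> {-L..L} \<Longrightarrow> f x = F 0 x"
    and x: "x \<in> {-L..L}"
  shows "(Dx L ^^ j) f x = F j x"
  using \<open>j \<le> s\<close> x
proof (induction j arbitrary: x)
  case 0
  then show ?case using f by simp
next
  case (Suc j)
  have "((Dx L ^^ j) f has_real_derivative F (Suc j) x) (at x within {-L..L})"
    by (rule has_field_derivative_transform_within[OF F, of _ _ 1]) (use Suc in auto)
  then show ?case
    using Suc.prems assms(1) by (simp add: Dx_eq)
qed

lemma funpow_Dx_DERIV:
  assumes "0 < L" "j < s"
    and F: "\<And>j x. j < s \<Longrightarrow> x \<in> {-L..L} \<Longrightarrow> (F j has_real_derivative F (Suc j) x) (at x within {-L..L})"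
    and f: "\<And>x. x \<in> {-L..L} \<Longrightarrow> f x = F 0 x"
    and x: "x \<in> {-L..L}"
  shows "((Dx L ^^ j) f has_real_derivative F (Suc j) x) (at x within {-L..L})"
proof (rule has_field_derivative_transform_within[OF F[OF assms(2) x], of 1])
  fix y assume "y \<in> {-L..L}"
  then show "F j y = (Dx L ^^ j) f y"
    using funpow_Dx_eq[of L j s F f y] assms by auto
qed (use x in auto)

lemma C_space_x_C1:
  assumes "w \<in> C_space L s" "j < s" "0 < L"
  shows "x_C1 T L (\<lambda>t. (Dx L ^^ j) w) (\<lambda>t. (Dx L ^^ Suc j) w)"
proof -
  have "((Dx L ^^ j) w has_real_derivative (Dx L ^^ Suc j) w x) (at x within {-L..L})"
    if "x \<in> {-L..L}" for x
  proof -
    from assms(1,2) that have "(Dx L ^^ j) w differentiable (at x within {-L..L})"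
      by (auto simp: C_space_def differentiable_on_def)
    then obtain D where D: "((Dx L ^^ j) w has_real_derivative D) (at x within {-L..L})"
      using real_differentiable_def by blast
    then have "(Dx L ^^ Suc j) w x = D"
      using assms(3) that by (simp add: Dx_eq)
    then show ?thesis using D by simp
  qed
  then show ?thesis
    using assms by (auto simp: x_C1_def C_space_def intro!: jointly_continuous_of_x simp del: funpow.simps)
qed

text \<open>\<open>F j\<close> is an explicit formula for the j-th space derivative. As
  \<open>v\<close> is tied to \<open>F 0\<close> on the rectangle only, the results apply to
  functions such as \<open>Dt T \<eta>\<close>, known there alone.\<close>

context
  fixes T L :: real and s :: nat and F :: "nat \<Rightarrow> real \<Rightarrow> real \<Rightarrow> real" and v :: "real \<Rightarrow> real \<Rightarrow> real"
  assumes L: "0 < L" and s: "0 < s"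
    and F: "\<And>j. j < s \<Longrightarrow> x_C1 T L (F j) (F (Suc j))"
    and v: "\<And>t x. t \<in> {0..T} \<Longrightarrow> x \<in> {-L..L} \<Longrightarrow> v t x = F 0 t x"
begin

lemma chain_DERIV:
  "j < s \<Longrightarrow> t \<in> {0..T} \<Longrightarrow> x \<in> {-L..L} \<Longrightarrow>
    (F j t has_real_derivative F (Suc j) t x) (at x within {-L..L})"
  using F by (auto simp: x_C1_def)

lemma chain_jointly_continuous: "j \<le> s \<Longrightarrow> jointly_continuous T L (F j)"
  using F[of j] F[of "j - 1"] s by (cases "j < s") (auto simp: x_C1_def)

lemma chain_Dx:
  "j \<le> s \<Longrightarrow> t \<in> {0..T} \<Longrightarrow> x \<in> {-L..L} \<Longrightarrow> (Dx L ^^ j) (v t) x = F j t x"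
  using funpow_Dx_eq[of L j s "\<lambda>j. F j t" "v t" x] L chain_DERIV v by blast

lemma chain_Dx_differentiable:
  assumes "j < s" "t \<in> {0..T}" "x \<in> {-L..L}"
  shows "(Dx L ^^ j) (v t) differentiable (at x within {-L..L})"
  using funpow_Dx_DERIV[of L j s "\<lambda>j. F j t" "v t" x] L chain_DERIV v assms
    real_differentiable_def by blast

lemma chain_C_space:
  assumes t: "t \<in> {0..T}"
  shows "v t \<in> C_space L s"
proof -
  have "continuous_on {-L..L} ((Dx L ^^ j) (v t))" if "j \<le> s" for j
    by (rule continuous_on_eq[OF jointly_continuous_x[OF chain_jointly_continuous[OF that] t]])
      (use chain_Dx[OF that t] in auto)
  then show ?thesis
    using chain_Dx_differentiable t by (auto simp: C_space_def differentiable_on_def)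
qed

text \<open>A jointly continuous function on the compact rectangle is uniformly continuous, so each
  derivative converges uniformly in \<open>x\<close> as time varies; there are finitely many orders
  to combine.\<close>

lemma chain_C_time:
  assumes X: "\<And>t. t \<in> {0..T} \<Longrightarrow> v t \<in> X"
  shows "v \<in> C_time T X (C_norm L s)"
proof -
  have "((\<lambda>\<tau>. C_norm L s (\<lambda>x. v \<tau> x - v t x)) \<longlongrightarrow> 0) (at t within {0..T})"
    if t: "t \<in> {0..T}" for t
  proof (rule tendstoI)
    fix e :: real
    assume "0 < e"
    then have e: "0 < e / 2" by simp
    have "\<forall>\<^sub>F \<tau> in at t within {0..T}. \<tau> \<in> {0..T} \<and> (\<forall>x\<in>{-L..L}. \<bar>F j \<tau> x - F j t x\<bar> \<le> e / 2)"
      if "j \<le> s" for j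
    proof -
      have "uniformly_continuous_on ({0..T} \<times> {-L..L}) (\<lambda>(t, x). F j t x)"
        using chain_jointly_continuous[OF that]
        by (intro compact_uniformly_continuous compact_Times) (auto simp: jointly_continuous_def)
      then obtain \<delta> where \<delta>: "0 < \<delta>" "\<And>p q. p \<in> {0..T} \<times> {-L..L} \<Longrightarrow> q \<in> {0..T} \<times> {-L..L} \<Longrightarrow>
          dist q p < \<delta> \<Longrightarrow> dist (case q of (t, x) \<Rightarrow> F j t x) (case p of (t, x) \<Rightarrow> F j t x) < e / 2"
        using e unfolding uniformly_continuous_on_def by metis
      have "\<bar>F j \<tau> x - F j t x\<bar> \<le> e / 2" if "\<tau> \<in> {0..T}" "dist \<tau> t < \<delta>" "x \<in> {-L..L}" for \<tau> x
        using \<delta>(2)[of "(t, x)" "(\<tau>, x)"] that t by (auto simp: dist_Pair_Pair dist_real_def)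
      then show ?thesis
        unfolding eventually_at using \<delta>(1) by blast
    qed
    then have "\<forall>\<^sub>F \<tau> in at t within {0..T}.
        \<forall>j\<in>{..s}. \<tau> \<in> {0..T} \<and> (\<forall>x\<in>{-L..L}. \<bar>F j \<tau> x - F j t x\<bar> \<le> e / 2)"
      by (intro eventually_ball_finite) auto
    then show "\<forall>\<^sub>F \<tau> in at t within {0..T}. dist (C_norm L s (\<lambda>x. v \<tau> x - v t x)) 0 < e"
    proof (rule eventually_mono)
      fix \<tau>
      assume \<tau>: "\<forall>j\<in>{..s}. \<tau> \<in> {0..T} \<and> (\<forall>x\<in>{-L..L}. \<bar>F j \<tau> x - F j t x\<bar> \<le> e / 2)"
      let ?D = "\<lambda>(j, x). \<bar>(Dx L ^^ j) (\<lambda>x. v \<tau> x - v t x) x\<bar>"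
      have "(Dx L ^^ j) (\<lambda>x. v \<tau> x - v t x) x = F j \<tau> x - F j t x"
        if "j \<le> s" "x \<in> {-L..L}" for j x
        using that t \<tau> L v chain_DERIV
        by (intro funpow_Dx_eq[of L j s "\<lambda>j x. F j \<tau> x - F j t x"]) (auto intro!: DERIV_diff)
      then have bound: "?D p \<le> e / 2" if "p \<in> {..s} \<times> {-L..L}" for p
        using \<tau> that by auto
      \<comment> \<open>This index makes the supremum one over a nonempty set and also shows that it
        is nonnegative.\<close>
      have mem: "(0, 0) \<in> {..s} \<times> {-L..L}" using L by auto
      have "C_norm L s (\<lambda>x. v \<tau> x - v t x) \<le> e / 2"
        unfolding C_norm_def using mem bound by (intro cSUP_least) blast+
      moreover have "?D (0, 0) \<le> C_norm L s (\<lambda>x. v \<tau> x - v t x)"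
        unfolding C_norm_def using mem bound by (intro cSUP_upper bdd_aboveI2[of _ _ "e / 2"]) auto
      then have "0 \<le> C_norm L s (\<lambda>x. v \<tau> x - v t x)"
        by (rule order_trans[rotated]) simp
      ultimately show "dist (C_norm L s (\<lambda>x. v \<tau> x - v t x)) 0 < e"
        using e by (simp add: dist_real_def)
    qed
  qed
  then show ?thesis
    using X by (simp add: C_time_def)
qed

end

lemma Dt_eq:
  fixes w :: "real \<Rightarrow> real"
  assumes "continuous_on {0..T} w" "0 < T" "t \<in> {0..T}"
    and "\<And>t. t \<in> {0..T} \<Longrightarrow> v t x = c + integral {0..t} w"
  shows "Dt T v t x = w t" "(\<lambda>\<tau>. v \<tau> x) differentiable (at t within {0..T})"
proof -
  have d: "((\<lambda>\<tau>. v \<tau> x) has_real_derivative w t) (at t within {0..T})"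
    by (rule DERIV_t_integral[OF assms(1) assms(4) assms(3)])
  then show "Dt T v t x = w t"
    unfolding Dt_def using assms by (intro vector_derivative_within_interval) auto
  show "(\<lambda>\<tau>. v \<tau> x) differentiable (at t within {0..T})"
    using d real_differentiable_def by blast
qed

lemma lebesgue_t_integral_eq:
  assumes "jointly_continuous T L w" "t \<in> {0..T}" "x \<in> {-L..L}"
    and "\<And>\<tau>. \<tau> \<in> {0..T} \<Longrightarrow> f \<tau> = w \<tau> x"
  shows "(LINT \<tau>|lebesgue_on {0..t}. f \<tau>) = integral {0..t} (\<lambda>\<tau>. w \<tau> x)"
proof -
  have "continuous_on {0..t} (\<lambda>\<tau>. w \<tau> x)"
    using assms by (intro jointly_continuous_t) auto
  then have "integrable (lebesgue_on {0..t}) (\<lambda>\<tau>. w \<tau> x)"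
    using absolutely_integrable_continuous_real[of 0 t "\<lambda>\<tau>. w \<tau> x"]
    by (simp add: integrable_restrict_space set_integrable_def)
  then have "(LINT \<tau>|lebesgue_on {0..t}. w \<tau> x) = integral {0..t} (\<lambda>\<tau>. w \<tau> x)"
    by (rule lebesgue_integral_eq_integral) simp
  moreover have "(LINT \<tau>|lebesgue_on {0..t}. f \<tau>) = (LINT \<tau>|lebesgue_on {0..t}. w \<tau> x)"
    using assms by (intro Bochner_Integration.integral_cong) auto
  ultimately show ?thesis by simp
qed

theorem proposition3p4:
  fixes L T a b d :: real
    and \<eta>\<^sub>0 u\<^sub>0 :: "real \<Rightarrow> real"
    and \<eta> u :: "real \<Rightarrow> real \<Rightarrow> real"
  assumes "L > 0" and "a < 0" and "b > 0" and "d > 0" and "a + b + d = 1 / 3"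
    and "\<eta>\<^sub>0 \<in> C2_tilde_0 L" and "u\<^sub>0 \<in> C3_0 L"
    and "T > 0"
    and "\<eta> \<in> H1_T L T" and "u \<in> H2_T L T"
    and "integral_system_solution a b d L T \<eta>\<^sub>0 u\<^sub>0 \<eta> u"
  shows "\<eta> \<in> C_time T (C2_tilde_0 L) (C_norm L 2) \<and>
         u \<in> C_time T (C3_0 L) (C_norm L 3) \<and>
         ibvp_solution a b d L T \<eta>\<^sub>0 u\<^sub>0 \<eta> u \<and>
         Dt T \<eta> \<in> C_time T (C2_tilde_0 L) (C_norm L 2) \<and>
         Dt T u \<in> C_time T (C3_0 L) (C_norm L 3)"
proof -
  note pos = \<open>L > 0\<close> \<open>a < 0\<close> \<open>b > 0\<close> \<open>d > 0\<close> \<open>T > 0\<close>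
  define E where "E t x = (a + b) / b * u t x + \<eta> t x * u t x" for t x
  define \<Phi> where "\<Phi> t x = \<eta> t x + 1 / 2 * (u t x)\<^sup>2" for t x
  \<comment> \<open>\<Lambda>N and \<Lambda>D are the values of the two operators along the
    solution; \<open>MN\<close> and \<open>MD\<close> are the parts of their space derivatives
    without the jump term.\<close>
  define \<Lambda>N where "\<Lambda>N t = green_value cosh sinh b L (E t)" for t
  define MN where "MN t = green_slope sinh b L (E t)" for t
  define \<Lambda>D where "\<Lambda>D t = green_value sinh cosh d L (\<Phi> t)" for t
  define MD where "MD t = green_slope cosh d L (\<Phi> t)" for t
  \<comment> \<open>The sign of \<open>a\<close> makes both coefficients positive, so the coupled
    system oscillates.\<close>
  define \<alpha> \<delta> where "\<alpha> = - a / b" and "\<delta> = 1 / d"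
  have \<alpha>\<delta>: "0 < \<alpha>" "0 < \<delta>" "a / b = - \<alpha>"
    using pos by (auto simp: \<alpha>_def \<delta>_def divide_neg_pos)

  \<comment> \<open>Joint continuity of the solution\<close>
  have cont\<eta>: "jointly_continuous T L \<eta>"
    unfolding jointly_continuous_def using assms(9) pos(1)
    by (intro C_time_H_space_continuous[of L \<eta> T "H_space L 1" 1]) (auto simp: H1_T_def)
  have contu: "jointly_continuous T L u"
    unfolding jointly_continuous_def using assms(10) pos(1)
    by (intro C_time_H_space_continuous[of L u T "H_space L 2 \<inter> H1_0 L" 2]) (auto simp: H2_T_def)
  have u_bd: "u t (-L) = 0" "u t L = 0" if "t \<in> {0..T}" for t
    using assms(10) that by (auto simp: H2_T_def C_time_def H1_0_def)
  have contE: "jointly_continuous T L E" and cont\<Phi>: "jointly_continuous T L \<Phi>"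
    unfolding E_def[abs_def] \<Phi>_def[abs_def] power2_eq_square
    by (intro jointly_continuous_add jointly_continuous_mult jointly_continuous_of_x[of _ "\<lambda>x. _"]
        cont\<eta> contu continuous_on_const)+

  \<comment> \<open>The Green's operators along the solution\<close>
  have wronskian: "cosh x * sinh y + sinh x * cosh y = sinh (x + y)"
    "sinh x * cosh y + cosh x * sinh y = sinh (x + y)" for x y :: real
    by (simp_all add: sinh_add)
  have dsinh: "(sinh has_real_derivative cosh x) (at x)" and dcosh: "(cosh has_real_derivative sinh x) (at x)"
    for x :: real by (auto intro!: derivative_eq_intros)
  \<comment> \<open>Instances of the assumptions on the pair \<open>h, g\<close>:
    \<open>cosh, sinh\<close> for the Neumann operator, \<open>sinh, cosh\<close> for the Dirichlet
    operator.\<close>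
  note N = dcosh dsinh wronskian(1) pos(3,1)
  note D = dsinh dcosh wronskian(2) pos(4,1)
  have \<Lambda>N: "x_C1 T L \<Lambda>N (\<lambda>t x. E t x / b + MN t x)"
    using green_value_x_C1[of cosh sinh b L, OF N contE] by (simp add: \<Lambda>N_def[abs_def] MN_def)
  have MN: "x_C1 T L MN (\<lambda>t x. \<Lambda>N t x / b)"
    using green_slope_x_C1[of cosh sinh b L, OF N contE] by (simp add: \<Lambda>N_def MN_def[abs_def])
  have \<Lambda>D: "x_C1 T L \<Lambda>D (\<lambda>t x. \<Phi> t x / d + MD t x)"
    using green_value_x_C1[of sinh cosh d L, OF D cont\<Phi>] by (simp add: \<Lambda>D_def[abs_def] MD_def)
  have MD: "x_C1 T L MD (\<lambda>t x. \<Lambda>D t x / d)"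
    using green_slope_x_C1[of sinh cosh d L, OF D cont\<Phi>] by (simp add: \<Lambda>D_def MD_def[abs_def])
  have MN_bd: "MN t (-L) = 0" "MN t L = 0" for t
    using green_slope_boundary[of cosh sinh b L "E t", OF N] by (simp_all add: MN_def)
  have \<Lambda>D_bd: "\<Lambda>D t (-L) = 0" "\<Lambda>D t L = 0" for t
    using green_value_boundary[of sinh cosh d L "\<Phi> t", OF D] by (simp_all add: \<Lambda>D_def)
  have L_N: "L_N b L (\<lambda>y. (a + b) / b * u t y + \<eta> t y * u t y) x = \<Lambda>N t x"
    and L_D: "L_D d L (\<lambda>y. \<eta> t y + 1 / 2 * (u t y)\<^sup>2) x = \<Lambda>D t x"
    if "t \<in> {0..T}" "x \<in> {-L..L}" for t x
    using green_operator_eq_green_value[of cosh sinh b L "E t" x, OF N jointly_continuous_x[OF contE that(1)] that(2)]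
      green_operator_eq_green_value[of sinh cosh d L "\<Phi> t" x, OF D jointly_continuous_x[OF cont\<Phi> that(1)] that(2)]
    by (simp_all add: L_N_def L_D_def \<Lambda>N_def \<Lambda>D_def E_def[abs_def] \<Phi>_def[abs_def])
  have jc: "jointly_continuous T L A" "jointly_continuous T L A'" if "x_C1 T L A A'" for A A'
    using that by (auto simp: x_C1_def)

  have u0: "x_C1 T L (\<lambda>t. u\<^sub>0) (\<lambda>t. Dx L u\<^sub>0)" "x_C1 T L (\<lambda>t. Dx L u\<^sub>0) (\<lambda>t. (Dx L ^^ 2) u\<^sub>0)"
    "x_C1 T L (\<lambda>t. (Dx L ^^ 2) u\<^sub>0) (\<lambda>t. (Dx L ^^ 3) u\<^sub>0)"
    using assms(7) pos(1) C_space_x_C1[of u\<^sub>0 L 3 0] C_space_x_C1[of u\<^sub>0 L 3 1] C_space_x_C1[of u\<^sub>0 L 3 2]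
    by (simp_all add: C3_0_def numeral_2_eq_2 numeral_3_eq_3)
  have \<eta>0: "x_C1 T L (\<lambda>t. \<eta>\<^sub>0) (\<lambda>t. Dx L \<eta>\<^sub>0)" "x_C1 T L (\<lambda>t. Dx L \<eta>\<^sub>0) (\<lambda>t. (Dx L ^^ 2) \<eta>\<^sub>0)"
    using assms(6) pos(1) C_space_x_C1[of \<eta>\<^sub>0 L 2 0] C_space_x_C1[of \<eta>\<^sub>0 L 2 1]
    by (simp_all add: C2_tilde_0_def numeral_2_eq_2)

  \<comment> \<open>The pointwise system for \<eta> and the space derivative of u\<close>
  have u_eq: "u t x = u\<^sub>0 x + integral {0..t} (\<lambda>\<tau>. \<Lambda>D \<tau> x)" if "t \<in> {0..T}" "x \<in> {-L..L}" for t x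
    using assms(11) that lebesgue_t_integral_eq[OF jc(1)[OF \<Lambda>D] that L_D[OF _ that(2)]]
    by (simp add: integral_system_solution_def)
  \<comment> \<open>The second equation differentiated under the integral. That this is the
    pointwise derivative of \<open>u\<close> up to the boundary is needed before the first equation,
    which contains \<open>Dx L (u \<tau>)\<close>, can be rewritten.\<close>
  define u\<^sub>x where "u\<^sub>x t x = Dx L u\<^sub>0 x + integral {0..t} (\<lambda>\<tau>. \<Phi> \<tau> x / d + MD \<tau> x)" for t x
  have u: "x_C1 T L u u\<^sub>x"
    by (rule x_C1_cong[OF x_C1_add[OF u0(1) x_C1_t_integral[OF \<Lambda>D]]]) (simp_all add: u_eq u\<^sub>x_def)
  have Dx_u: "Dx L (u t) x = u\<^sub>x t x" if "t \<in> {0..T}" "x \<in> {-L..L}" for t x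
    using u that pos(1) by (intro Dx_eq) (auto simp: x_C1_def)
  have \<eta>_rate: "jointly_continuous T L (\<lambda>t x. \<Lambda>N t x - \<alpha> * u\<^sub>x t x)"
    using jointly_continuous_add[OF jc(1)[OF \<Lambda>N] jointly_continuous_mult[OF jointly_continuous_of_t jc(2)[OF u], of "\<lambda>t. - \<alpha>"]]
    by simp
  have \<eta>_eq: "\<eta> t x = \<eta>\<^sub>0 x + integral {0..t} (\<lambda>\<tau>. \<Lambda>N \<tau> x - \<alpha> * u\<^sub>x \<tau> x)"
    if "t \<in> {0..T}" "x \<in> {-L..L}" for t x
  proof -
    have "L_N b L (\<lambda>y. (a + b) / b * u \<tau> y + \<eta> \<tau> y * u \<tau> y) x + a / b * Dx L (u \<tau>) x
        = \<Lambda>N \<tau> x - \<alpha> * u\<^sub>x \<tau> x" if "\<tau> \<in> {0..T}" for \<tau>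
      unfolding L_N[OF that \<open>x \<in> {-L..L}\<close>] Dx_u[OF that \<open>x \<in> {-L..L}\<close>] \<alpha>\<delta>(3) by simp
    from lebesgue_t_integral_eq[OF \<eta>_rate that this] show ?thesis
      using assms(11) that by (simp add: integral_system_solution_def)
  qed

  \<comment> \<open>Two gains of regularity\<close>
  \<comment> \<open>The rate of \<open>u\<^sub>x\<close> splits into the coupling term \<delta>
    \<eta> and this remainder, which is already continuously differentiable in
    \<open>x\<close>.\<close>
  define s where "s t x = 1 / (2 * d) * (u t x * u t x) + MD t x" for t x
  define s' where "s' t x = 1 / (2 * d) * (u\<^sub>x t x * u t x + u\<^sub>x t x * u t x) + \<Lambda>D t x / d" for t x
  have s: "x_C1 T L s s'"
    unfolding s_def[abs_def] s'_def[abs_def] by (intro x_C1_add x_C1_cmult x_C1_mult u MD)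
  have u\<^sub>x_eq: "u\<^sub>x t x = Dx L u\<^sub>0 x + integral {0..t} (\<lambda>\<tau>. \<delta> * \<eta> \<tau> x + s \<tau> x)" for t x
  proof -
    have "\<Phi> \<tau> x / d + MD \<tau> x = \<delta> * \<eta> \<tau> x + s \<tau> x" for \<tau>
      by (simp add: \<Phi>_def s_def \<delta>_def power2_eq_square add_divide_distrib)
    then show ?thesis by (simp add: u\<^sub>x_def)
  qed
  obtain \<eta>\<^sub>x u\<^sub>x\<^sub>x where \<eta>: "x_C1 T L \<eta> \<eta>\<^sub>x" and ux: "x_C1 T L u\<^sub>x u\<^sub>x\<^sub>x"
    and \<eta>\<^sub>x_eq: "\<And>t x. t \<in> {0..T} \<Longrightarrow> x \<in> {-L..L} \<Longrightarrow>
      \<eta>\<^sub>x t x = Dx L \<eta>\<^sub>0 x + integral {0..t} (\<lambda>\<tau>. E \<tau> x / b + MN \<tau> x - \<alpha> * u\<^sub>x\<^sub>x \<tau> x)"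
    and u\<^sub>x\<^sub>x_eq: "\<And>t x. t \<in> {0..T} \<Longrightarrow> x \<in> {-L..L} \<Longrightarrow>
      u\<^sub>x\<^sub>x t x = (Dx L ^^ 2) u\<^sub>0 x + integral {0..t} (\<lambda>\<tau>. \<delta> * \<eta>\<^sub>x \<tau> x + s' \<tau> x)"
    by (rule rotating_system_regularity[OF \<alpha>\<delta>(1,2) pos(1) cont\<eta> jc(2)[OF u] \<Lambda>N s \<eta>0(1) u0(2)
          \<eta>_eq u\<^sub>x_eq]) blast+

  \<comment> \<open>Now that \<eta> and \<open>u\<^sub>x\<close> are continuously differentiable in
    \<open>x\<close>, so are the differentiated forcing terms, and the rotation argument applies
    again to the pair (\<open>\<eta>\<^sub>x\<close>, \<open>u\<^sub>x\<^sub>x\<close>).\<close>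
  define E\<^sub>x where "E\<^sub>x t x = (a + b) / b * u\<^sub>x t x + (\<eta>\<^sub>x t x * u t x + u\<^sub>x t x * \<eta> t x)" for t x
  define \<Phi>\<^sub>x where "\<Phi>\<^sub>x t x = \<eta>\<^sub>x t x + 1 / 2 * (u\<^sub>x t x * u t x + u\<^sub>x t x * u t x)" for t x
  have E: "x_C1 T L E E\<^sub>x"
    unfolding E_def[abs_def] E\<^sub>x_def[abs_def] by (intro x_C1_add x_C1_cmult x_C1_mult u \<eta>)
  have \<Phi>: "x_C1 T L \<Phi> \<Phi>\<^sub>x"
    unfolding \<Phi>_def[abs_def] \<Phi>\<^sub>x_def[abs_def] power2_eq_square
    by (intro x_C1_add x_C1_cmult x_C1_mult u \<eta>)
  have r': "x_C1 T L (\<lambda>t x. E t x / b + MN t x) (\<lambda>t x. E\<^sub>x t x / b + \<Lambda>N t x / b)"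
    using x_C1_add[OF x_C1_cmult[OF E, of "1 / b"] MN] by simp
  define s'' where "s'' t x = 1 / (2 * d) *
      ((u\<^sub>x\<^sub>x t x * u t x + u\<^sub>x t x * u\<^sub>x t x) + (u\<^sub>x\<^sub>x t x * u t x + u\<^sub>x t x * u\<^sub>x t x)) +
      (1 / d) * (\<Phi> t x / d + MD t x)" for t x
  have s': "x_C1 T L s' s''"
    using x_C1_add[OF x_C1_cmult[OF x_C1_add[OF x_C1_mult[OF ux u] x_C1_mult[OF ux u]], of "1 / (2 * d)"]
        x_C1_cmult[OF \<Lambda>D, of "1 / d"]]
    by (simp add: s'_def[abs_def] s''_def[abs_def])
  obtain \<eta>\<^sub>x\<^sub>x u\<^sub>x\<^sub>x\<^sub>x where \<eta>x: "x_C1 T L \<eta>\<^sub>x \<eta>\<^sub>x\<^sub>x" and uxx: "x_C1 T L u\<^sub>x\<^sub>x u\<^sub>x\<^sub>x\<^sub>x"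
    and \<eta>\<^sub>x\<^sub>x_eq: "\<And>t x. t \<in> {0..T} \<Longrightarrow> x \<in> {-L..L} \<Longrightarrow> \<eta>\<^sub>x\<^sub>x t x =
      (Dx L ^^ 2) \<eta>\<^sub>0 x + integral {0..t} (\<lambda>\<tau>. E\<^sub>x \<tau> x / b + \<Lambda>N \<tau> x / b - \<alpha> * u\<^sub>x\<^sub>x\<^sub>x \<tau> x)"
    by (rule rotating_system_regularity[OF \<alpha>\<delta>(1,2) pos(1) jc(2)[OF \<eta>] jc(2)[OF ux] r' s' \<eta>0(2) u0(3)
          \<eta>\<^sub>x_eq u\<^sub>x\<^sub>x_eq]) blast+

  \<comment> \<open>Boundary conditions\<close>
  have slope_bd: "\<eta>\<^sub>x t x = 0 \<and> u\<^sub>x\<^sub>x t x = 0" if t: "t \<in> {0..T}" and x: "x = -L \<or> x = L" for t x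
  proof (rule rotating_system_zero[OF \<alpha>\<delta>(1,2) _ _ _ _ t])
    have x': "x \<in> {-L..L}" using x pos(1) by auto
    show "continuous_on {0..T} (\<lambda>t. \<eta>\<^sub>x t x)" "continuous_on {0..T} (\<lambda>t. u\<^sub>x\<^sub>x t x)"
      using jointly_continuous_t[OF jc(2)[OF \<eta>] x' order_refl]
        jointly_continuous_t[OF jc(2)[OF ux] x' order_refl] by auto
    have initial: "Dx L \<eta>\<^sub>0 x = 0" "(Dx L ^^ 2) u\<^sub>0 x = 0"
      using assms(6,7) x by (auto simp: C2_tilde_0_def C3_0_def)
    \<comment> \<open>At the endpoints \<open>u\<close> vanishes, hence so does E; \<open>MN\<close>
      and \<Lambda>D vanish there by the boundary behavior of the two kernels.\<close>
    have forcing: "E \<tau> x / b + MN \<tau> x = 0" "s' \<tau> x = 0" if "\<tau> \<in> {0..T}" for \<tau>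
      using x u_bd[OF that] MN_bd \<Lambda>D_bd by (auto simp: E_def s'_def)
    show "\<eta>\<^sub>x t x = integral {0..t} (\<lambda>\<tau>. - \<alpha> * u\<^sub>x\<^sub>x \<tau> x)"
      "u\<^sub>x\<^sub>x t x = integral {0..t} (\<lambda>\<tau>. \<delta> * \<eta>\<^sub>x \<tau> x)" if "t \<in> {0..T}" for t
    proof -
      have "integral {0..t} (\<lambda>\<tau>. E \<tau> x / b + MN \<tau> x - \<alpha> * u\<^sub>x\<^sub>x \<tau> x)
          = integral {0..t} (\<lambda>\<tau>. - \<alpha> * u\<^sub>x\<^sub>x \<tau> x)"
        "integral {0..t} (\<lambda>\<tau>. \<delta> * \<eta>\<^sub>x \<tau> x + s' \<tau> x) = integral {0..t} (\<lambda>\<tau>. \<delta> * \<eta>\<^sub>x \<tau> x)"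
        by (rule Henstock_Kurzweil_Integration.integral_cong; use forcing that in simp)+
      then show "\<eta>\<^sub>x t x = integral {0..t} (\<lambda>\<tau>. - \<alpha> * u\<^sub>x\<^sub>x \<tau> x)"
        "u\<^sub>x\<^sub>x t x = integral {0..t} (\<lambda>\<tau>. \<delta> * \<eta>\<^sub>x \<tau> x)"
        unfolding \<eta>\<^sub>x_eq[OF that x'] u\<^sub>x\<^sub>x_eq[OF that x'] initial by simp_all
    qed
  qed

  \<comment> \<open>Membership in the spaces of differentiable functions\<close>
  have pos23: "0 < (2::nat)" "0 < (3::nat)"
    by simp_all
  have lt2: "j < 2 \<longleftrightarrow> j = 0 \<or> j = 1" and lt3: "j < 3 \<longleftrightarrow> j = 0 \<or> j = 1 \<or> j = 2" for j :: nat
    by auto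
  \<comment> \<open>The family of derivatives is given as a list, indexed by the order of
    differentiation.\<close>
  have chain2: "x_C1 T L ([A, A', A''] ! j) ([A, A', A''] ! Suc j)"
    if "x_C1 T L A A'" "x_C1 T L A' A''" "j < 2" for A A' A'' j
    using that by (auto simp: lt2)
  have chain3: "x_C1 T L ([A, A', A'', A'''] ! j) ([A, A', A'', A'''] ! Suc j)"
    if "x_C1 T L A A'" "x_C1 T L A' A''" "x_C1 T L A'' A'''" "j < 3" for A A' A'' A''' j
    using that by (auto simp: lt3)

  have in_C2: "v \<in> C_time T (C2_tilde_0 L) (C_norm L 2)"
    if A: "x_C1 T L A A'" "x_C1 T L A' A''" "\<And>t x. t \<in> {0..T} \<Longrightarrow> x \<in> {-L..L} \<Longrightarrow> v t x = A t x"
      and bd: "\<And>t x. t \<in> {0..T} \<Longrightarrow> x = -L \<or> x = L \<Longrightarrow> A' t x = 0" for v A A' A''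
  proof -
    have v: "v t x = ([A, A', A''] ! 0) t x" if "t \<in> {0..T}" "x \<in> {-L..L}" for t x
      using A(3)[OF that] by simp
    note chain = pos(1) pos23(1) chain2[OF A(1,2)] v
    have "v t \<in> C2_tilde_0 L" if t: "t \<in> {0..T}" for t
      using chain_C_space[OF chain t] chain_Dx[OF chain, of 1 t L] chain_Dx[OF chain, of 1 t "-L"]
        bd[OF t] t pos(1) by (simp add: C2_tilde_0_def)
    then show ?thesis
      by (intro chain_C_time[OF chain]) auto
  qed
  have in_C3: "v \<in> C_time T (C3_0 L) (C_norm L 3)"
    if A: "x_C1 T L A A'" "x_C1 T L A' A''" "x_C1 T L A'' A'''"
        "\<And>t x. t \<in> {0..T} \<Longrightarrow> x \<in> {-L..L} \<Longrightarrow> v t x = A t x"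
      and bd: "\<And>t x. t \<in> {0..T} \<Longrightarrow> x = -L \<or> x = L \<Longrightarrow> A t x = 0 \<and> A'' t x = 0"
    for v A A' A'' A'''
  proof -
    have v: "v t x = ([A, A', A'', A'''] ! 0) t x" if "t \<in> {0..T}" "x \<in> {-L..L}" for t x
      using A(4)[OF that] by simp
    note chain = pos(1) pos23(2) chain3[OF A(1-3)] v
    have "v t \<in> C3_0 L" if t: "t \<in> {0..T}" for t
      using chain_C_space[OF chain t] chain_Dx[OF chain, of 2 t L] chain_Dx[OF chain, of 2 t "-L"]
        bd[OF t] A(4)[OF t] t pos(1) by (simp add: C3_0_def)
    then show ?thesis
      by (intro chain_C_time[OF chain]) auto
  qed

  \<comment> \<open>Time derivatives and their regularity\<close>
  \<comment> \<open>The time derivative of \<eta> is the integrand of its equation, and its space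
    derivatives are the integrands for \<open>\<eta>\<^sub>x\<close> and
    \<open>\<eta>\<^sub>x\<^sub>x\<close>. For \<open>u\<close> the corresponding chain starts at
    \<Lambda>D.\<close>
  have \<eta>t: "x_C1 T L (\<lambda>t x. \<Lambda>N t x - \<alpha> * u\<^sub>x t x) (\<lambda>t x. E t x / b + MN t x - \<alpha> * u\<^sub>x\<^sub>x t x)"
    and \<eta>tx: "x_C1 T L (\<lambda>t x. E t x / b + MN t x - \<alpha> * u\<^sub>x\<^sub>x t x)
      (\<lambda>t x. E\<^sub>x t x / b + \<Lambda>N t x / b - \<alpha> * u\<^sub>x\<^sub>x\<^sub>x t x)"
    by (intro x_C1_diff x_C1_cmult \<Lambda>N r' ux uxx)+
  define \<Phi>\<^sub>x\<^sub>x where "\<Phi>\<^sub>x\<^sub>x t x = \<eta>\<^sub>x\<^sub>x t x + 1 / 2 *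
      ((u\<^sub>x\<^sub>x t x * u t x + u\<^sub>x t x * u\<^sub>x t x) + (u\<^sub>x\<^sub>x t x * u t x + u\<^sub>x t x * u\<^sub>x t x))" for t x
  have \<Phi>x: "x_C1 T L \<Phi>\<^sub>x \<Phi>\<^sub>x\<^sub>x"
    unfolding \<Phi>\<^sub>x_def[abs_def] \<Phi>\<^sub>x\<^sub>x_def[abs_def] by (intro x_C1_add x_C1_cmult x_C1_mult u ux \<eta>x)
  have utx: "x_C1 T L (\<lambda>t x. \<Phi> t x / d + MD t x) (\<lambda>t x. \<Phi>\<^sub>x t x / d + \<Lambda>D t x / d)"
    using x_C1_add[OF x_C1_cmult[OF \<Phi>, of "1 / d"] MD] by simp
  have utxx: "x_C1 T L (\<lambda>t x. \<Phi>\<^sub>x t x / d + \<Lambda>D t x / d)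
      (\<lambda>t x. \<Phi>\<^sub>x\<^sub>x t x / d + (\<Phi> t x / d + MD t x) / d)"
    using x_C1_add[OF x_C1_cmult[OF \<Phi>x, of "1 / d"] x_C1_cmult[OF \<Lambda>D, of "1 / d"]] by simp

  have Dt\<eta>: "Dt T \<eta> t x = \<Lambda>N t x - \<alpha> * u\<^sub>x t x" "(\<lambda>\<tau>. \<eta> \<tau> x) differentiable (at t within {0..T})"
    and Dtu: "Dt T u t x = \<Lambda>D t x" "(\<lambda>\<tau>. u \<tau> x) differentiable (at t within {0..T})"
    if t: "t \<in> {0..T}" and x: "x \<in> {-L..L}" for t x
    using Dt_eq[where v=\<eta> and x=x, OF jointly_continuous_t[OF \<eta>_rate x order_refl] pos(5) t \<eta>_eq[OF _ x]]
      Dt_eq[where v=u and x=x, OF jointly_continuous_t[OF jc(1)[OF \<Lambda>D] x order_refl] pos(5) t u_eq[OF _ x]]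
    by auto

  \<comment> \<open>The differential equations\<close>
  have start\<eta>: "\<eta> t x = ([\<eta>, \<eta>\<^sub>x, \<eta>\<^sub>x\<^sub>x] ! 0) t x"
    and startu: "u t x = ([u, u\<^sub>x, u\<^sub>x\<^sub>x, u\<^sub>x\<^sub>x\<^sub>x] ! 0) t x" for t x
    by simp_all
  note chain\<eta> = pos(1) pos23(1) chain2[OF \<eta> \<eta>x] start\<eta>
  note chainu = pos(1) pos23(2) chain3[OF u ux uxx] startu
  have Dx\<eta>: "Dx L (\<eta> t) x = \<eta>\<^sub>x t x" "(Dx L ^^ 2) (\<eta> t) x = \<eta>\<^sub>x\<^sub>x t x"
    and Dxu: "Dx L (u t) x = u\<^sub>x t x" "(Dx L ^^ 2) (u t) x = u\<^sub>x\<^sub>x t x" "(Dx L ^^ 3) (u t) x = u\<^sub>x\<^sub>x\<^sub>x t x"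
    if "t \<in> {0..T}" "x \<in> {-L..L}" for t x
    using chain_Dx[OF chain\<eta>, of 1 t x] chain_Dx[OF chain\<eta>, of 2 t x]
      chain_Dx[OF chainu, of 1 t x] chain_Dx[OF chainu, of 2 t x]
      chain_Dx[OF chainu, of 3 t x] that
    by (simp_all add: numeral_3_eq_3 numeral_2_eq_2)
  have Dx\<eta>u: "Dx L (\<lambda>y. \<eta> t y * u t y) x = \<eta>\<^sub>x t x * u t x + u\<^sub>x t x * \<eta> t x"
    if "t \<in> {0..T}" "x \<in> {-L..L}" for t x
    using x_C1_mult[OF \<eta> u] that pos(1) by (intro Dx_eq) (auto simp: x_C1_def)
  have Dt\<eta>xx: "Dt T (\<lambda>\<tau>. (Dx L ^^ 2) (\<eta> \<tau>)) t x = E\<^sub>x t x / b + \<Lambda>N t x / b - \<alpha> * u\<^sub>x\<^sub>x\<^sub>x t x"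
      "(\<lambda>\<tau>. (Dx L ^^ 2) (\<eta> \<tau>) x) differentiable (at t within {0..T})"
    and Dtuxx: "Dt T (\<lambda>\<tau>. (Dx L ^^ 2) (u \<tau>)) t x = \<delta> * \<eta>\<^sub>x t x + s' t x"
      "(\<lambda>\<tau>. (Dx L ^^ 2) (u \<tau>) x) differentiable (at t within {0..T})"
    if t: "t \<in> {0..T}" and x: "x \<in> {-L..L}" for t x
  proof -
    have "(Dx L ^^ 2) (\<eta> \<tau>) x = (Dx L ^^ 2) \<eta>\<^sub>0 x +
        integral {0..\<tau>} (\<lambda>\<tau>. E\<^sub>x \<tau> x / b + \<Lambda>N \<tau> x / b - \<alpha> * u\<^sub>x\<^sub>x\<^sub>x \<tau> x)" if "\<tau> \<in> {0..T}" for \<tau>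
      using Dx\<eta>(2)[OF that x] \<eta>\<^sub>x\<^sub>x_eq[OF that x] by simp
    from Dt_eq[where v="\<lambda>\<tau>. (Dx L ^^ 2) (\<eta> \<tau>)" and x=x,
        OF jointly_continuous_t[OF jc(2)[OF \<eta>tx] x order_refl] pos(5) t this]
    show "Dt T (\<lambda>\<tau>. (Dx L ^^ 2) (\<eta> \<tau>)) t x = E\<^sub>x t x / b + \<Lambda>N t x / b - \<alpha> * u\<^sub>x\<^sub>x\<^sub>x t x"
      "(\<lambda>\<tau>. (Dx L ^^ 2) (\<eta> \<tau>) x) differentiable (at t within {0..T})" by auto
    have "jointly_continuous T L (\<lambda>t x. \<delta> * \<eta>\<^sub>x t x + s' t x)"
      by (rule jc(1)[OF x_C1_add[OF x_C1_cmult[OF \<eta>x] s']])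
    moreover have "(Dx L ^^ 2) (u \<tau>) x = (Dx L ^^ 2) u\<^sub>0 x +
        integral {0..\<tau>} (\<lambda>\<tau>. \<delta> * \<eta>\<^sub>x \<tau> x + s' \<tau> x)" if "\<tau> \<in> {0..T}" for \<tau>
      using Dxu(2)[OF that x] u\<^sub>x\<^sub>x_eq[OF that x] by simp
    ultimately show "Dt T (\<lambda>\<tau>. (Dx L ^^ 2) (u \<tau>)) t x = \<delta> * \<eta>\<^sub>x t x + s' t x"
      "(\<lambda>\<tau>. (Dx L ^^ 2) (u \<tau>) x) differentiable (at t within {0..T})"
      using Dt_eq[where v="\<lambda>\<tau>. (Dx L ^^ 2) (u \<tau>)" and x=x,
          OF jointly_continuous_t[OF _ x order_refl] pos(5) t] by blast+
  qed

  show ?thesis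
  proof (intro conjI)
    show "\<eta> \<in> C_time T (C2_tilde_0 L) (C_norm L 2)"
      by (rule in_C2[OF \<eta> \<eta>x refl]) (use slope_bd in blast)
    show "u \<in> C_time T (C3_0 L) (C_norm L 3)"
      by (rule in_C3[OF u ux uxx refl]) (use slope_bd u_bd in blast)
    show "Dt T \<eta> \<in> C_time T (C2_tilde_0 L) (C_norm L 2)"
    proof (rule in_C2[OF \<eta>t \<eta>tx Dt\<eta>(1)])
      show "E t x / b + MN t x - \<alpha> * u\<^sub>x\<^sub>x t x = 0" if "t \<in> {0..T}" "x = -L \<or> x = L" for t x
        using slope_bd[OF that] u_bd[OF that(1)] MN_bd that(2) by (auto simp: E_def)
    qed
    show "Dt T u \<in> C_time T (C3_0 L) (C_norm L 3)"
    proof (rule in_C3[OF \<Lambda>D utx utxx Dtu(1)])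
      \<comment> \<open>The second space derivative of \<open>Dt T u\<close> is built from
        \<open>\<Phi>\<^sub>x\<close> = \<open>\<eta>\<^sub>x\<close> + u \<open>u\<^sub>x\<close>
        and \<Lambda>D, all zero at the endpoints.\<close>
      show "\<Lambda>D t x = 0 \<and> \<Phi>\<^sub>x t x / d + \<Lambda>D t x / d = 0" if "t \<in> {0..T}" "x = -L \<or> x = L" for t x
        using slope_bd[OF that] u_bd[OF that(1)] \<Lambda>D_bd that(2) by (auto simp: \<Phi>\<^sub>x_def)
    qed
    \<comment> \<open>The nonlocal terms cancel: \<Lambda>N against b (\<Lambda>N / b) and
      \<Lambda>D against d (\<Lambda>D / d). With b \<alpha> = -a and d \<delta> = 1 the rest is
      algebra; the two terms in \<open>u\<^sub>x\<close> combine as a/b - (a + b)/b = -1.\<close>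
    have "Dt T \<eta> t x + Dx L (u t) x + Dx L (\<lambda>y. \<eta> t y * u t y) x + a * (Dx L ^^ 3) (u t) x
          - b * Dt T (\<lambda>\<tau>. (Dx L ^^ 2) (\<eta> \<tau>)) t x = 0"
      and "Dt T u t x + Dx L (\<eta> t) x + u t x * Dx L (u t) x
          - d * Dt T (\<lambda>\<tau>. (Dx L ^^ 2) (u \<tau>)) t x = 0"
      if tx: "t \<in> {0..T}" "x \<in> {-L..L}" for t x
      unfolding Dt\<eta>(1)[OF tx] Dtu(1)[OF tx] Dx\<eta>(1)[OF tx] Dxu(1)[OF tx] Dxu(3)[OF tx] Dx\<eta>u[OF tx]
        Dt\<eta>xx(1)[OF tx] Dtuxx(1)[OF tx]
      using pos by (simp_all add: E\<^sub>x_def s'_def \<alpha>_def \<delta>_def field_simps)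
    moreover have "\<eta> 0 x = \<eta>\<^sub>0 x \<and> u 0 x = u\<^sub>0 x" if "x \<in> {-L..L}" for x
      using \<eta>_eq[OF _ that, of 0] u_eq[OF _ that, of 0] pos(5) by simp
    moreover have "(Dx L ^^ 2) (u t) (-L) = 0 \<and> (Dx L ^^ 2) (u t) L = 0" if "t \<in> {0..T}" for t
      using Dxu(2)[OF that] slope_bd[OF that] pos(1) by simp
    moreover note Dt\<eta>(2) Dtu(2) Dt\<eta>xx(2) Dtuxx(2) u_bd
      chain_Dx_differentiable[OF chain\<eta>] chain_Dx_differentiable[OF chainu]
    ultimately show "ibvp_solution a b d L T \<eta>\<^sub>0 u\<^sub>0 \<eta> u"
      unfolding ibvp_solution_def greaterThanLessThan_iff atLeastAtMost_iff
      by (auto simp del: funpow.simps)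
  qed
qed

end
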